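(* There exists an ordinary Dirichlet series $\sum_{n=1}^\infty a_n n^{-s}$ of homogeneity $2$ whose abscissae satisfy $$\sigma_a-\sigma_b = \frac14, \qquad \sigma_b-\sigma_c \ge \frac14 .$$
   Context: An ordinary Dirichlet series is a series $\sum_{n=1}^\infty a_n n^{-s}$ with $a_n\in\mathbb{C}$ and $s=\sigma+it\in\mathbb{C}$; convergence means convergence of the sequence of partial sums $\sum_{n=1}^N a_n n^{-s}$. For $\sigma\in\mathbb{R}$ let $\Omega_\sigma=\{s\in\mathbb{C}:\Re s>\sigma\}$. The abscissae are $\sigma_a=\inf\{\sigma:\sum a_n n^{-s}\text{ converges absolutely for all } s\in\Omega_\sigma\}$, $\sigma_b=\inf\{\sigma:\sum a_n n^{-s}\text{ converges to a bounded function on }\Omega_\sigma\}$, $\sigma_c=\inf\{\sigma:\sum a_n n^{-s}\text{ converges for all }s\in\Omega_\sigma\}$. Let $\Lambda(n)$ denote the number of prime factors of $n$ counted with multiplicity. The series is of homogeneity $M$ if it contains only terms of homogeneity exactly $M$, i.e. $a_n\neq 0$ implies $\Lambda(n)=M$. *)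

theory Defs
  imports "HOL-Analysis.Analysis" "HOL-Computational_Algebra.Computational_Algebra"
begin

(* A sequence a :: nat => complex stands for its values a 1, a 2, ...; the value a 0 is never used.
   All series are written with the index shift n |-> Suc n, so that they start at n = 1. *)

definition dterm :: "(nat \<Rightarrow> complex) \<Rightarrow> complex \<Rightarrow> nat \<Rightarrow> complex" where
  "dterm a s n = a n * of_nat n powr (- s)"

definition dirichlet_converges :: "(nat \<Rightarrow> complex) \<Rightarrow> complex \<Rightarrow> bool" where
  "dirichlet_converges a s \<longleftrightarrow> summable (\<lambda>n. dterm a s (Suc n))"

definition dirichlet_abs_converges :: "(nat \<Rightarrow> complex) \<Rightarrow> complex \<Rightarrow> bool" where
  "dirichlet_abs_converges a s \<longleftrightarrow> summable (\<lambda>n. norm (dterm a s (Suc n)))"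

definition dirichlet_sum :: "(nat \<Rightarrow> complex) \<Rightarrow> complex \<Rightarrow> complex" where
  "dirichlet_sum a s = (\<Sum>n. dterm a s (Suc n))"

definition right_half_plane :: "real \<Rightarrow> complex set" where
  "right_half_plane \<sigma> = {s. Re s > \<sigma>}"

(* The abscissae are extended reals, so that the infimum of the empty set is \<infinity> and
   that of a set without lower bound is -\<infinity>. *)

definition abscissa_abs :: "(nat \<Rightarrow> complex) \<Rightarrow> ereal" where
  "abscissa_abs a =
     Inf (ereal ` {\<sigma>. \<forall>s\<in>right_half_plane \<sigma>. dirichlet_abs_converges a s})"

definition abscissa_bdd :: "(nat \<Rightarrow> complex) \<Rightarrow> ereal" where
  "abscissa_bdd a =
     Inf (ereal ` {\<sigma>. (\<forall>s\<in>right_half_plane \<sigma>. dirichlet_converges a s) \<and>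
                      bounded (dirichlet_sum a ` right_half_plane \<sigma>)})"

definition abscissa_conv :: "(nat \<Rightarrow> complex) \<Rightarrow> ereal" where
  "abscissa_conv a =
     Inf (ereal ` {\<sigma>. \<forall>s\<in>right_half_plane \<sigma>. dirichlet_converges a s})"

definition num_prime_factors :: "nat \<Rightarrow> nat" where
  "num_prime_factors n = size (prime_factorization n)"

definition homogeneous :: "nat \<Rightarrow> (nat \<Rightarrow> complex) \<Rightarrow> bool" where
  "homogeneous M a \<longleftrightarrow> (\<forall>n\<ge>1. a n \<noteq> 0 \<longrightarrow> num_prime_factors n = M)"

end

theory Submission
  imports Defs "HOL-Real_Asymp.Real_Asymp"
begin

text \<open>
The series is a sum of finite blocks that live on disjoint, very rapidly growing intervals of
integers, block \<open>m\<close> being a bilinear form in primes.  For a large \<open>X\<close> and a small \<open>\<delta>\<close> choose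
\<open>n = 4^k\<close> primes \<open>p_i\<close> and \<open>n\<close> other primes \<open>q_j\<close> in \<open>(X^(1-\<delta>), X]\<close>, with \<open>n\<close> at least
\<open>X^(1-\<delta>)\<close>; Chebyshev's lower bound for the number of primes makes this possible.  Let \<open>H\<close> be an
\<open>n \<times> n\<close> matrix with entries \<open>\<plusminus>1\<close> such that \<open>H / sqrt n\<close> is orthogonal and all row sums equal
\<open>sqrt n\<close>, and put
\<open>a(p_i q_j) = 4^m n^(-3/2) H(i,j) (p_i q_j)^(i \<tau>)\<close>.

Since all the primes are about \<open>X\<close>, and \<open>n\<close> is about \<open>X\<close> as well, the three abscissae can be
read off, with the normalisation \<open>\<sigma>\<^sub>b = 0\<close>:

  \<^item> \<open>\<sigma>\<^sub>a = 1/4\<close>: the sum of \<open>|a(N)| N^(-\<sigma>)\<close> over a block has about the size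
    \<open>n^(-3/2) n^2 X^(-2\<sigma>)\<close>, that is, \<open>X^(1/2 - 2\<sigma>)\<close>.

  \<^item> \<open>\<sigma>\<^sub>b = 0\<close>: by orthogonality a bilinear form in \<open>H\<close> with arguments bounded by \<open>u\<close> is at
    most \<open>n^(3/2) u^2\<close>, so that a block is at most \<open>4^m X^(-2\<sigma>(1-\<delta>))\<close> on the line
    \<open>Re s = \<sigma> \<ge> 0\<close>.  At the point \<open>s = i \<tau>\<close> the form is evaluated at the all-ones vectors and the
    block equals \<open>4^m\<close>, which exceeds twice the total contribution of the earlier blocks; the
    later blocks are negligible there, because they are chosen after \<open>\<tau>\<close>.

  \<^item> \<open>\<sigma>\<^sub>c \<le> -1/4\<close>: for a typical \<open>\<tau>\<close> the partial sums of the coefficients within a block behave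
    like those of a random walk, hence have the size of the square root of the sum of
    \<open>|a(N)|^2\<close>, namely \<open>n^(-1/2)\<close>, up to logarithms.  Summation by parts turns this into
    \<open>X^(-1/2 - 2 Re s)\<close> for the partial sums of the series.

The same twist \<open>N^(i \<tau>)\<close> thus serves two purposes: it moves the peak of the block to the known
height \<open>\<tau>\<close>, and it destroys the correlations in the partial sums.  The existence of \<open>\<tau>\<close> is
\<open>exists_twist_with_small_partial_sums\<close>, a Rademacher-Menshov argument in which the averages over
\<open>\<tau>\<close> play the role of expectations.  All properties of one block are collected in
\<open>exists_good_block\<close>, and \<open>blockwise_summable\<close> is the convergence criterion for the whole series.
\<close>

section \<open>Chebyshev's lower bound for the number of primes\<close>

definition primes_upto :: "nat \<Rightarrow> nat set" where
  "primes_upto m = {p. prime p \<and> p \<le> m}"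

lemma finite_primes_upto [simp]: "finite (primes_upto m)"
  by (rule finite_subset[of _ "{..m}"]) (auto simp: primes_upto_def)

text \<open>The \<open>D\<close> constructed here is the least common multiple of \<open>1, \<dots>, m\<close>.  Written as the product of the
largest prime powers not exceeding \<open>m\<close>, it has one factor, of size at most \<open>m\<close>, for each prime.\<close>

lemma common_multiple_le_power_prime_count:
  assumes "m > 0"
  obtains D :: nat where "D > 0" "D \<le> m ^ card (primes_upto m)"
    "\<And>i. 1 \<le> i \<Longrightarrow> i \<le> m \<Longrightarrow> i dvd D"
proof -
  define e where "e = (\<lambda>p::nat. GREATEST k. p ^ k \<le> m)"
  have bound: "k \<le> m" if "p \<in> primes_upto m" "p ^ k \<le> m" for p k :: nat
  proof -
    have "p \<ge> 2" using that by (auto simp: primes_upto_def prime_ge_2_nat)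
    have "k < 2 ^ k" by simp
    also have "2 ^ k \<le> p ^ k" using \<open>p \<ge> 2\<close> by (rule power_mono) simp
    finally show ?thesis using that by linarith
  qed
  have e1: "p ^ e p \<le> m" if "p \<in> primes_upto m" for p
    unfolding e_def
    by (rule GreatestI_nat[of "\<lambda>k. p ^ k \<le> m" 0 m]) (use bound that assms in auto)
  have e2: "k \<le> e p" if "p \<in> primes_upto m" "p ^ k \<le> m" for p k
    unfolding e_def
    by (rule Greatest_le_nat[of "\<lambda>k. p ^ k \<le> m" k m]) (use bound that in auto)
  define D where "D = (\<Prod>p\<in>primes_upto m. p ^ e p)"
  have "D > 0" unfolding D_def
    by (rule prod_pos) (auto simp: primes_upto_def prime_gt_0_nat)
  moreover have "D \<le> m ^ card (primes_upto m)"
  proof -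
    have "D \<le> (\<Prod>p\<in>primes_upto m. m)" unfolding D_def by (rule prod_mono) (use e1 in auto)
    thus ?thesis by simp
  qed
  moreover have "i dvd D" if i: "1 \<le> i" "i \<le> m" for i
  proof -
    have "i = (\<Prod>p\<in>prime_factors i. p ^ multiplicity p i)"
      using i prime_factorization_nat[of i] by auto
    also have "\<dots> dvd D" unfolding D_def
    proof (rule prod_dvd_prod_subset2)
      show "prime_factors i \<subseteq> primes_upto m"
        using i by (auto simp: primes_upto_def in_prime_factors_iff dest!: dvd_imp_le)
      fix p assume p: "p \<in> prime_factors i"
      have "p ^ multiplicity p i \<le> i" using i by (intro dvd_imp_le multiplicity_dvd) auto
      with p i \<open>prime_factors i \<subseteq> primes_upto m\<close> have "multiplicity p i \<le> e p"
        by (intro e2) auto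
      thus "p ^ multiplicity p i dvd p ^ e p" by (rule le_imp_power_dvd)
    qed simp
    finally show ?thesis .
  qed
  ultimately show ?thesis using that by blast
qed

text \<open>Up to the factor \<open>D\<close> these are the entries of the Leibniz harmonic triangle.  Each of them is the
difference of two entries in the preceding column, and the first column consists of the
reciprocals \<open>1/r\<close>; hence every common multiple of \<open>1, \<dots>, m\<close> clears all denominators up to
row \<open>m\<close>.\<close>

lemma leibniz_triangle_integral:
  fixes D m :: nat
  assumes D: "\<And>i. 1 \<le> i \<Longrightarrow> i \<le> m \<Longrightarrow> i dvd D"
  assumes "1 \<le> c" "c \<le> r" "r \<le> m"
  shows "(real D / (real c * real (r choose c))) \<in> \<int>"
  using assms(2-)
proof (induction c arbitrary: r rule: nat_induct_at_least)
  case base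
  then obtain k where "D = r * k" using D[of r] by auto
  thus ?case using base by auto
next
  case (Suc c)
  obtain r' where r: "r = Suc r'" "c \<le> r'" using Suc.prems by (cases r) auto
  define C where "C = real (r' choose c)"
  have C: "C > 0" using r by (simp add: C_def)
  have c: "real c > 0" using Suc by simp
  have a1: "real (Suc c) * real (r choose Suc c) = real r * C"
    unfolding C_def r(1) of_nat_mult[symmetric] by (subst Suc_times_binomial) (rule refl)
  have a2: "real (Suc r' - c) * real (r choose c) = real r * C"
    unfolding C_def r(1) of_nat_mult[symmetric] by (subst binomial_absorb_comp) simp
  have a3: "real (Suc r' - c) = real r - real c" "real r - real c > 0" using r by auto
  have a4: "real (r choose c) = real r * C / (real r - real c)"
    using a2 a3 by (simp add: field_simps)
  have "real D / (real (Suc c) * real (r choose Suc c)) = 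
        real D / (real c * C) - real D / (real c * real (r choose c))"
    unfolding a1 a4 using C c a3 by (simp add: divide_simps) (simp add: algebra_simps)
  moreover have "real D / (real c * C) \<in> \<int>" 
    unfolding C_def using r Suc.prems by (intro Suc.IH) auto
  moreover have "real D / (real c * real (r choose c)) \<in> \<int>" 
    using r Suc.prems by (intro Suc.IH) auto
  ultimately show ?case by (metis Ints_diff)
qed

text \<open>By the integrality in the harmonic triangle, \<open>j (2j choose j)\<close> divides the common multiple \<open>D\<close>,
so the size of the central binomial coefficient bounds \<open>D\<close> from below.\<close>

lemma chebyshev_lower:
  assumes "j > 0"
  shows "4 ^ j \<le> 2 * real (2 * j) ^ card (primes_upto (2 * j))"
proof -
  obtain D :: nat where D: "D > 0" "D \<le> (2 * j) ^ card (primes_upto (2 * j))"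
    "\<And>i. 1 \<le> i \<Longrightarrow> i \<le> 2 * j \<Longrightarrow> i dvd D"
    using common_multiple_le_power_prime_count[of "2 * j"] assms by auto
  have "(real D / (real j * real ((2 * j) choose j))) \<in> \<int>"
    by (rule leibniz_triangle_integral[of "2 * j"]) (use D(3) assms in auto)
  moreover have *: "real D / (real j * real ((2 * j) choose j)) > 0" using D(1) assms by simp
  ultimately have "real D / (real j * real ((2 * j) choose j)) \<ge> 1"
    by (auto elim!: Ints_cases)
  hence "real j * real ((2 * j) choose j) \<le> real D" using * assms by (simp add: field_simps)
  moreover have "4 ^ j / (2 * real j) \<le> real ((2 * j) choose j)"
    by (rule central_binomial_lower_bound[OF assms])
  ultimately have "4 ^ j \<le> 2 * real D" using assms by (simp add: field_simps)
  also have "real D \<le> real ((2 * j) ^ card (primes_upto (2 * j)))" using D(2) by linarith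
  finally show ?thesis by (simp only: of_nat_power)
qed

text \<open>Discarding the small primes costs almost nothing, since there are about
\<open>x / ln x\<close> primes up to \<open>x\<close>.  The factor 8 leaves room for two disjoint families whose common
size is a power of 4.\<close>

lemma eventually_many_primes:
  assumes "d > 0"
  shows "eventually (\<lambda>j. 8 * real (2 * j) powr (1 - d) \<le> 
     card {p. prime p \<and> real (2 * j) powr (1 - d) < real p \<and> p \<le> 2 * j}) sequentially"
proof -
  have e: "eventually (\<lambda>j. (real j * ln 4 - ln 2) / ln (2 * real j) \<ge> 10 * (2 * real j) powr (1 - d)) sequentially"
    using assms by real_asymp
  have e2: "eventually (\<lambda>j::nat. (2 * real j) powr (1 - d) \<le> 2 * real j) sequentially"
    using assms by real_asymp
  show ?thesis using e e2 eventually_gt_at_top[of "0::nat"]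
  proof eventually_elim
    case (elim j)
    define Y where "Y = real (2 * j) powr (1 - d)"
    define S where "S = {p. prime p \<and> real (2 * j) powr (1 - d) < real p \<and> p \<le> 2 * j}"
    have l: "ln (2 * real j) > 0" using elim by simp
    have "ln (4 ^ j) \<le> ln (2 * real (2 * j) ^ card (primes_upto (2 * j)))"
      using chebyshev_lower[of j] elim by (subst ln_le_cancel_iff) auto
    also have "\<dots> = ln 2 + card (primes_upto (2 * j)) * ln (2 * real j)"
      using elim by (simp add: ln_mult ln_realpow algebra_simps)
    finally have "real j * ln 4 - ln 2 \<le> card (primes_upto (2 * j)) * ln (2 * real j)"
      by (simp add: ln_realpow)
    hence "(real j * ln 4 - ln 2) / ln (2 * real j) \<le> card (primes_upto (2 * j))"
      using l by (simp add: field_simps)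
    hence big: "10 * Y \<le> card (primes_upto (2 * j))" using elim by (simp add: Y_def)
    have "primes_upto (2 * j) \<subseteq> S \<union> {1..nat \<lfloor>Y\<rfloor>}"
    proof
      fix p assume p: "p \<in> primes_upto (2 * j)"
      show "p \<in> S \<union> {1..nat \<lfloor>Y\<rfloor>}"
      proof (cases "real p \<le> Y")
        case True
        hence "p \<le> nat \<lfloor>Y\<rfloor>" by (rule le_nat_floor)
        thus ?thesis using p by (auto simp: primes_upto_def dest: prime_ge_1_nat)
      qed (use p in \<open>auto simp: primes_upto_def Y_def S_def\<close>)
    qed
    moreover have "finite S" unfolding S_def by (rule finite_subset[of _ "{..2 * j}"]) auto
    ultimately have "card (primes_upto (2 * j)) \<le> card (S \<union> {1..nat \<lfloor>Y\<rfloor>})"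
      by (auto intro!: card_mono)
    also have "\<dots> \<le> card S + nat \<lfloor>Y\<rfloor>" using card_Un_le[of S "{1..nat \<lfloor>Y\<rfloor>}"] by simp
    finally have c: "real (card (primes_upto (2 * j))) \<le> card S + real (nat \<lfloor>Y\<rfloor>)" by linarith
    have "real (nat \<lfloor>Y\<rfloor>) \<le> Y" by (rule of_nat_floor) (simp add: Y_def)
    with c big have "9 * Y \<le> card S" by linarith
    moreover have "Y \<ge> 0" by (simp add: Y_def)
    ultimately have "8 * Y \<le> card S" by linarith
    thus ?case by (simp only: Y_def S_def)
  qed
qed

section \<open>A Hadamard matrix with constant row sums\<close>

text \<open>This is the \<open>k\<close>-th tensor power of the \<open>4 \<times> 4\<close> matrix \<open>J - 2I\<close>, where \<open>J\<close> is the all-ones matrix,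
indexed by the base-4 digits of row and column.  The smaller matrix is a Hadamard matrix whose rows
all sum to 2, and both properties pass to tensor powers.  Constant row sums ensure that
the all-ones vectors attain the maximum of the bilinear form.\<close>

fun hadamard :: "nat \<Rightarrow> nat \<Rightarrow> nat \<Rightarrow> real" where
  "hadamard 0 i j = 1"
| "hadamard (Suc k) i j =
     (if i mod 4 = j mod 4 then - 1 else 1) * hadamard k (i div 4) (j div 4)"

lemma abs_hadamard [simp]: "\<bar>hadamard k i j\<bar> = 1"
  by (induction k arbitrary: i j) (auto simp: abs_mult)

lemma hadamard_Suc_digits:
  assumes "r < 4" "s < 4"
  shows "hadamard (Suc k) (4 * i + r) (4 * j + s) = (if r = s then - 1 else 1) * hadamard k i j"
  using assms by simp

lemma sum_lessThan_mult_4: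
  fixes f :: "nat \<Rightarrow> 'a :: comm_monoid_add"
  shows "(\<Sum>i<4 * n. f i) = (\<Sum>i<n. f (4 * i) + f (4 * i + 1) + f (4 * i + 2) + f (4 * i + 3))"
proof (induction n)
  case (Suc n)
  have "{..<4 * Suc n} = insert (4 * n + 3) (insert (4 * n + 2) (insert (4 * n + 1) (insert (4 * n) {..<4 * n})))"
    by auto
  thus ?case using Suc by (simp add: ac_simps)
qed simp

lemma hadamard_row_sum: "(\<Sum>j<4 ^ k. hadamard k i j) = 2 ^ k"
proof (induction k arbitrary: i)
  case (Suc k)
  define q r where "q = i div 4" and "r = i mod 4"
  have i: "i = 4 * q + r" "r < 4" by (auto simp: q_def r_def)
  have r: "r = 0 \<or> r = 1 \<or> r = 2 \<or> r = 3" using i(2) by linarith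
  have "(\<Sum>j<4 ^ Suc k. hadamard (Suc k) i j) = (\<Sum>j<4 ^ k. 2 * hadamard k q j)"
    unfolding power_Suc sum_lessThan_mult_4 i(1)
    by (intro sum.cong refl)
       (use r hadamard_Suc_digits[of r 0 k q] hadamard_Suc_digits[of r 1 k q]
          hadamard_Suc_digits[of r 2 k q] hadamard_Suc_digits[of r 3 k q] in
         \<open>auto simp del: hadamard.simps\<close>)
  also have "\<dots> = 2 * 2 ^ k" by (simp add: Suc flip: sum_distrib_left)
  finally show ?case by simp
qed simp

text \<open>The matrix \<open>J - 2I\<close> is twice an orthogonal matrix.\<close>

lemma norm_J_minus_2I:
  fixes a b c d :: complex
  shows "(cmod (-a + b + c + d))\<^sup>2 + (cmod (a - b + c + d))\<^sup>2 + 
         (cmod (a + b - c + d))\<^sup>2 + (cmod (a + b + c - d))\<^sup>2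
       = 4 * ((cmod a)\<^sup>2 + (cmod b)\<^sup>2 + (cmod c)\<^sup>2 + (cmod d)\<^sup>2)"
  by (simp add: cmod_power2) (simp add: power2_eq_square algebra_simps)

lemma hadamard_isometry:
  fixes y :: "nat \<Rightarrow> complex"
  shows "(\<Sum>i<4 ^ k. (cmod (\<Sum>j<4 ^ k. of_real (hadamard k i j) * y j))\<^sup>2)
       = 4 ^ k * (\<Sum>j<4 ^ k. (cmod (y j))\<^sup>2)"
proof (induction k arbitrary: y)
  case (Suc k)
  define v where "v = (\<lambda>s i. \<Sum>j<4 ^ k. complex_of_real (hadamard k i j) * y (4 * j + s))"
  have row: "(\<Sum>j<4 ^ Suc k. of_real (hadamard (Suc k) (4 * i + r) j) * y j)
     = (if r = 0 then - v 0 i else v 0 i) + (if r = 1 then - v 1 i else v 1 i) +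
       (if r = 2 then - v 2 i else v 2 i) + (if r = 3 then - v 3 i else v 3 i)" 
    if "r < 4" for i r
  proof -
    have r: "r = 0 \<or> r = 1 \<or> r = 2 \<or> r = 3" using that by linarith
    have "(\<Sum>j<4 ^ Suc k. of_real (hadamard (Suc k) (4 * i + r) j) * y j)
      = (\<Sum>j<4 ^ k. of_real (if r = 0 then - hadamard k i j else hadamard k i j) * y (4 * j)
         + of_real (if r = 1 then - hadamard k i j else hadamard k i j) * y (4 * j + 1)
         + of_real (if r = 2 then - hadamard k i j else hadamard k i j) * y (4 * j + 2)
         + of_real (if r = 3 then - hadamard k i j else hadamard k i j) * y (4 * j + 3))"
      unfolding power_Suc sum_lessThan_mult_4
      by (intro sum.cong refl)
         (use r hadamard_Suc_digits[of r 0 k i] hadamard_Suc_digits[of r 1 k i]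
            hadamard_Suc_digits[of r 2 k i] hadamard_Suc_digits[of r 3 k i] in
           \<open>auto simp del: hadamard.simps\<close>)
    thus ?thesis by (simp add: sum.distrib v_def sum_negf)
  qed
  have "(\<Sum>i<4 ^ Suc k. (cmod (\<Sum>j<4 ^ Suc k. of_real (hadamard (Suc k) i j) * y j))\<^sup>2)
     = (\<Sum>i<4 ^ k. 4 * ((cmod (v 0 i))\<^sup>2 + (cmod (v 1 i))\<^sup>2 + (cmod (v 2 i))\<^sup>2 + (cmod (v 3 i))\<^sup>2))"
    (is "_ = ?R")
  proof -
    have "(\<Sum>i<4 ^ Suc k. (cmod (\<Sum>j<4 ^ Suc k. of_real (hadamard (Suc k) i j) * y j))\<^sup>2)
      = (\<Sum>i<4 ^ k. (cmod (- v 0 i + v 1 i + v 2 i + v 3 i))\<^sup>2 + (cmod (v 0 i - v 1 i + v 2 i + v 3 i))\<^sup>2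
          + (cmod (v 0 i + v 1 i - v 2 i + v 3 i))\<^sup>2 + (cmod (v 0 i + v 1 i + v 2 i - v 3 i))\<^sup>2)"
      (is "?L = _")
    proof -
      define F where "F = (\<lambda>i. (cmod (\<Sum>j<4 ^ Suc k. of_real (hadamard (Suc k) i j) * y j))\<^sup>2)"
      have "?L = sum F {..<4 * 4 ^ k}" by (simp only: F_def power_Suc)
      also have "\<dots> = (\<Sum>i<4 ^ k. F (4 * i + 0) + F (4 * i + 1) + F (4 * i + 2) + F (4 * i + 3))"
        by (subst sum_lessThan_mult_4) simp
      finally show ?thesis by (simp only: F_def row) simp
    qed
    thus ?thesis by (simp only: norm_J_minus_2I)
  qed
  also have "\<dots> = 4 * (4 ^ k * (\<Sum>j<4 ^ k. (cmod (y (4 * j)))\<^sup>2 + (cmod (y (4 * j + 1)))\<^sup>2 +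
        (cmod (y (4 * j + 2)))\<^sup>2 + (cmod (y (4 * j + 3)))\<^sup>2))"
    by (simp only: v_def sum.distrib Suc.IH flip: sum_distrib_left) (simp add: algebra_simps)
  also have "\<dots> = 4 ^ Suc k * (\<Sum>j<4 ^ Suc k. (cmod (y j))\<^sup>2)"
    by (simp add: sum_lessThan_mult_4)
  finally show ?case .
qed simp

text \<open>Cauchy-Schwarz combined with the isometry: \<open>8^k = n^(3/2)\<close> for \<open>n = 4^k\<close>, which beats the trivial
bound \<open>n^2\<close> by the factor \<open>sqrt n\<close> that separates bounded from absolute convergence.\<close>

lemma hadamard_bilinear_bound:
  fixes x y :: "nat \<Rightarrow> complex"
  assumes x: "\<And>i. i < 4 ^ k \<Longrightarrow> cmod (x i) \<le> a" and y: "\<And>i. i < 4 ^ k \<Longrightarrow> cmod (y i) \<le> a"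
  shows "cmod (\<Sum>i<4 ^ k. \<Sum>j<4 ^ k. of_real (hadamard k i j) * (x i * y j)) \<le> 8 ^ k * a\<^sup>2"
proof -
  define w where "w = (\<lambda>i. \<Sum>j<4 ^ k. of_real (hadamard k i j) * y j)"
  have a: "a \<ge> 0" using order_trans[OF norm_ge_zero x[of 0]] by simp
  have sq: "(\<Sum>i<4 ^ k. (cmod (u i))\<^sup>2) \<le> 4 ^ k * a\<^sup>2" 
    if "\<And>i. i < 4 ^ k \<Longrightarrow> cmod (u i) \<le> a" for u :: "nat \<Rightarrow> complex"
  proof -
    have "(\<Sum>i<4 ^ k. (cmod (u i))\<^sup>2) \<le> (\<Sum>i<(4::nat) ^ k. a\<^sup>2)"
      using that by (intro sum_mono power_mono) auto
    thus ?thesis by simp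
  qed
  have "(cmod (\<Sum>i<4 ^ k. \<Sum>j<4 ^ k. of_real (hadamard k i j) * (x i * y j)))\<^sup>2
      = (cmod (\<Sum>i<4 ^ k. x i * w i))\<^sup>2"
    by (simp add: w_def sum_distrib_left mult_ac)
  also have "\<dots> \<le> (\<Sum>i<4 ^ k. cmod (x i) * cmod (w i))\<^sup>2"
    by (intro power_mono sum_norm_le) (auto simp: norm_mult)
  also have "\<dots> \<le> (\<Sum>i<4 ^ k. (cmod (x i))\<^sup>2) * (\<Sum>i<4 ^ k. (cmod (w i))\<^sup>2)"
    by (rule Cauchy_Schwarz_ineq_sum)
  also have "\<dots> \<le> (4 ^ k * a\<^sup>2) * (4 ^ k * (4 ^ k * a\<^sup>2))"
    unfolding w_def hadamard_isometry
    by (intro mult_mono sq mult_left_mono x y) (auto intro!: sum_nonneg mult_nonneg_nonneg)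
  also have "\<dots> = (8 ^ k * a\<^sup>2)\<^sup>2"
  proof -
    have "(4 ^ k * (4 ^ k * 4 ^ k) :: real) = (8 ^ k)\<^sup>2"
      by (simp add: power2_eq_square flip: power_mult_distrib)
    thus ?thesis by (simp add: power2_eq_square)
  qed
  finally show ?thesis using a by (simp add: power2_le_iff_abs_le)
qed

section \<open>Twists with small partial sums\<close>

text \<open>The sum of the squared norms of the sums of \<open>v\<close> over all dyadic subintervals of
\<open>[a, a + 2^K)\<close>.\<close>

fun dyadic_energy :: "(nat \<Rightarrow> complex) \<Rightarrow> nat \<Rightarrow> nat \<Rightarrow> real" where
  "dyadic_energy v 0 a = (cmod (v a))\<^sup>2"
| "dyadic_energy v (Suc K) a = (cmod (sum v {a..<a + 2 ^ Suc K}))\<^sup>2 +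
     dyadic_energy v K a + dyadic_energy v K (a + 2 ^ K)"

lemma dyadic_energy_nonneg: "dyadic_energy v K a \<ge> 0"
  by (induction K arbitrary: a) (auto intro!: add_nonneg_nonneg)

lemma dyadic_energy_ge: "(cmod (sum v {a..<a + 2 ^ K}))\<^sup>2 \<le> dyadic_energy v K a"
  by (cases K) (auto simp: dyadic_energy_nonneg add_nonneg_nonneg simp flip: add.assoc)

text \<open>The deterministic half of the Rademacher-Menshov inequality.  An initial segment is a union of at
most one dyadic interval of each length, so Cauchy-Schwarz bounds all initial segments
simultaneously by one quadratic quantity, which can then be averaged.\<close>

lemma partial_sum_le_dyadic_energy:
  assumes "x \<le> 2 ^ K"
  shows "(cmod (sum v {a..<a + x}))\<^sup>2 \<le> real (Suc K) * dyadic_energy v K a"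
  using assms
proof (induction K arbitrary: a x)
  case 0
  then show ?case by (cases x) auto
next
  case (Suc K)
  define E1 E2 where "E1 = dyadic_energy v K a" and "E2 = dyadic_energy v K (a + 2 ^ K)"
  have E: "E1 \<ge> 0" "E2 \<ge> 0" by (simp_all add: E1_def E2_def dyadic_energy_nonneg)
  have EE: "E1 + E2 \<le> dyadic_energy v (Suc K) a" by (simp add: E1_def E2_def)
  show ?case
  proof (cases "x \<le> 2 ^ K")
    case True
    have "(cmod (sum v {a..<a + x}))\<^sup>2 \<le> real (Suc K) * E1"
      unfolding E1_def by (rule Suc.IH[OF True])
    also have "\<dots> \<le> real (Suc (Suc K)) * dyadic_energy v (Suc K) a"
      using E EE by (intro mult_mono) auto
    finally show ?thesis .
  next
    case False
    define y where "y = x - 2 ^ K"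
    have y: "x = 2 ^ K + y" "y \<le> 2 ^ K" using False Suc.prems by (auto simp: y_def)
    define p q where "p = cmod (sum v {a..<a + 2 ^ K})" and "q = cmod (sum v {a + 2 ^ K..<(a + 2 ^ K) + y})"
    have "sum v {a..<a + x} = sum v {a..<a + 2 ^ K} + sum v {a + 2 ^ K..<(a + 2 ^ K) + y}"
      using y(1) by (subst sum.atLeastLessThan_concat) (auto simp: add.assoc)
    hence "cmod (sum v {a..<a + x}) \<le> p + q" by (simp add: p_def q_def norm_triangle_ineq)
    hence "(cmod (sum v {a..<a + x}))\<^sup>2 \<le> (p + q)\<^sup>2" by (intro power_mono) auto
    \<comment> \<open>Cauchy-Schwarz with the weights 1 and \<open>K + 1\<close>\<close>
    also have "(p + q)\<^sup>2 \<le> real (Suc (Suc K)) * (p\<^sup>2 + q\<^sup>2 / real (Suc K))"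
    proof -
      define l where "l = real (Suc K)"
      have l: "l > 0" "real (Suc (Suc K)) = l + 1" by (auto simp: l_def)
      have "l * ((l + 1) * (p\<^sup>2 + q\<^sup>2 / l) - (p + q)\<^sup>2) = (l * p - q)\<^sup>2"
        using l by (simp add: field_simps power2_eq_square)
      hence "l * ((l + 1) * (p\<^sup>2 + q\<^sup>2 / l) - (p + q)\<^sup>2) \<ge> 0" by simp
      hence "(l + 1) * (p\<^sup>2 + q\<^sup>2 / l) - (p + q)\<^sup>2 \<ge> 0" using l by (simp add: zero_le_mult_iff)
      thus ?thesis unfolding l l_def[symmetric] by simp
    qed
    also have "\<dots> \<le> real (Suc (Suc K)) * (E1 + E2)"
    proof (intro mult_left_mono add_mono)
      show "p\<^sup>2 \<le> E1" unfolding p_def E1_def by (rule dyadic_energy_ge)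
      have "q\<^sup>2 \<le> real (Suc K) * E2" unfolding q_def E2_def by (rule Suc.IH[OF y(2)])
      thus "q\<^sup>2 / real (Suc K) \<le> E2" by (simp add: field_simps)
    qed auto
    also have "\<dots> \<le> real (Suc (Suc K)) * dyadic_energy v (Suc K) a"
      using EE by (intro mult_left_mono) auto
    finally show ?thesis .
  qed
qed

lemma mean_powers_unit_complex:
  fixes z :: complex
  assumes "cmod z = 1"
  shows "(\<lambda>T. (\<Sum>t<T. z ^ t) / of_nat T) \<longlonglongrightarrow> (if z = 1 then 1 else 0)"
proof (cases "z = 1")
  case True
  have "(\<lambda>T. (\<Sum>t<T. z ^ t) / of_nat T) \<longlonglongrightarrow> 1"
    by (rule tendsto_eventually, rule eventually_mono[OF eventually_gt_at_top[of 0]]) (auto simp: True)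
  thus ?thesis using True by simp
next
  case False
  have "(\<lambda>T. (\<Sum>t<T. z ^ t) / of_nat T) \<longlonglongrightarrow> 0"
  proof (rule Lim_null_comparison)
    show "\<forall>\<^sub>F T in sequentially. cmod ((\<Sum>t<T. z ^ t) / of_nat T) \<le> (2 / cmod (1 - z)) / real T"
    proof (intro always_eventually allI)
      fix T
      have "cmod (\<Sum>t<T. z ^ t) = cmod (1 - z ^ T) / cmod (1 - z)"
        using False by (simp add: sum_gp_strict norm_divide)
      also have "\<dots> \<le> 2 / cmod (1 - z)"
        using norm_triangle_ineq4[of 1 "z ^ T"] assms by (intro divide_right_mono) (auto simp: norm_power)
      finally show "cmod ((\<Sum>t<T. z ^ t) / of_nat T) \<le> (2 / cmod (1 - z)) / real T"
        using divide_right_mono[of _ _ "real T"] by (simp add: norm_divide divide_divide_eq_left[symmetric] del: divide_divide_eq_left)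
    qed
    show "(\<lambda>T. (2 / cmod (1 - z)) / real T) \<longlonglongrightarrow> 0" by (rule lim_const_over_n)
  qed
  thus ?thesis using False by simp
qed

text \<open>Different unimodular numbers generate asymptotically orthogonal geometric progressions.\<close>

lemma mean_square_tendsto:
  fixes c z :: "nat \<Rightarrow> complex"
  assumes S: "finite S" and z: "\<And>N. N \<in> S \<Longrightarrow> cmod (z N) = 1" and inj: "inj_on z S"
  shows "(\<lambda>T. (\<Sum>t<T. (cmod (\<Sum>N\<in>S. c N * z N ^ t))\<^sup>2) / real T) \<longlonglongrightarrow> (\<Sum>N\<in>S. (cmod (c N))\<^sup>2)"
proof -
  have eq: "complex_of_real ((\<Sum>t<T. (cmod (\<Sum>N\<in>S. c N * z N ^ t))\<^sup>2) / real T)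
      = (\<Sum>N\<in>S. \<Sum>M\<in>S. c N * cnj (c M) * ((\<Sum>t<T. (z N * cnj (z M)) ^ t) / of_nat T))" for T
  proof -
    have "complex_of_real (\<Sum>t<T. (cmod (\<Sum>N\<in>S. c N * z N ^ t))\<^sup>2) =
       (\<Sum>t<T. \<Sum>N\<in>S. \<Sum>M\<in>S. c N * cnj (c M) * (z N * cnj (z M)) ^ t)"
      by (simp add: complex_norm_square sum_product power_mult_distrib mult_ac del: of_real_power)
    also have "\<dots> = (\<Sum>N\<in>S. \<Sum>M\<in>S. \<Sum>t<T. c N * cnj (c M) * (z N * cnj (z M)) ^ t)"
      by (subst sum.swap) (intro sum.cong refl sum.swap)
    finally have "complex_of_real (\<Sum>t<T. (cmod (\<Sum>N\<in>S. c N * z N ^ t))\<^sup>2) = \<dots>" .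
    thus ?thesis unfolding of_real_divide of_real_of_nat_eq
      by (simp only: sum_divide_distrib sum_distrib_left times_divide_eq_right)
  qed
  have one: "z N * cnj (z M) = 1 \<longleftrightarrow> N = M" if "N \<in> S" "M \<in> S" for N M
  proof -
    have M: "cnj (z M) * z M = 1" using z[OF that(2)] complex_norm_square[of "z M"] by (simp add: mult.commute)
    have "z N = z M" if "z N * cnj (z M) = 1"
    proof -
      have "z N = z N * (cnj (z M) * z M)" using M by simp
      also have "\<dots> = z M" using that by (simp flip: mult.assoc)
      finally show ?thesis .
    qed
    thus ?thesis using M that inj by (auto simp: inj_on_def mult.commute)
  qed
  have "(\<lambda>T. \<Sum>N\<in>S. \<Sum>M\<in>S. c N * cnj (c M) * ((\<Sum>t<T. (z N * cnj (z M)) ^ t) / of_nat T))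
     \<longlonglongrightarrow> (\<Sum>N\<in>S. \<Sum>M\<in>S. c N * cnj (c M) * (if z N * cnj (z M) = 1 then 1 else 0))"
    by (intro tendsto_intros mean_powers_unit_complex) (auto simp: norm_mult z)
  also have "(\<Sum>N\<in>S. \<Sum>M\<in>S. c N * cnj (c M) * (if z N * cnj (z M) = 1 then 1 else 0))
     = (\<Sum>N\<in>S. \<Sum>M\<in>S. if N = M then c N * cnj (c M) else 0)"
    by (intro sum.cong refl) (auto simp: one)
  also have "\<dots> = complex_of_real (\<Sum>N\<in>S. (cmod (c N))\<^sup>2)"
    using S by (simp add: complex_norm_square del: of_real_power)
  finally show ?thesis unfolding eq[symmetric] by (simp only: tendsto_of_real_iff)
qed

lemma mean_dyadic_energy_tendsto:
  fixes c z :: "nat \<Rightarrow> complex"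
  assumes z: "\<And>N. N \<in> {a..<a + 2 ^ K} \<Longrightarrow> cmod (z N) = 1" and inj: "inj_on z {a..<a + 2 ^ K}"
  shows "(\<lambda>T. (\<Sum>t<T. dyadic_energy (\<lambda>N. c N * z N ^ t) K a) / real T)
     \<longlonglongrightarrow> real (Suc K) * (\<Sum>N\<in>{a..<a + 2 ^ K}. (cmod (c N))\<^sup>2)"
  using assms
proof (induction K arbitrary: a)
  case 0
  thus ?case using mean_square_tendsto[of "{a}" z c] by simp
next
  case (Suc K)
  have sub: "{a..<a + 2 ^ K} \<subseteq> {a..<a + 2 ^ Suc K}" "{a + 2 ^ K..<a + 2 ^ K + 2 ^ K} \<subseteq> {a..<a + 2 ^ Suc K}"
    by auto
  let ?e = "\<lambda>A. \<Sum>N\<in>A. (cmod (c N))\<^sup>2"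
  have "(\<lambda>T. (\<Sum>t<T. (cmod (\<Sum>N\<in>{a..<a + 2 ^ Suc K}. c N * z N ^ t))\<^sup>2) / real T
       + (\<Sum>t<T. dyadic_energy (\<lambda>N. c N * z N ^ t) K a) / real T
       + (\<Sum>t<T. dyadic_energy (\<lambda>N. c N * z N ^ t) K (a + 2 ^ K)) / real T)
     \<longlonglongrightarrow> ?e {a..<a + 2 ^ Suc K} + real (Suc K) * ?e {a..<a + 2 ^ K} + 
        real (Suc K) * ?e {a + 2 ^ K..<a + 2 ^ K + 2 ^ K}"
    by (intro tendsto_add mean_square_tendsto Suc.IH Suc.prems)
       (use Suc.prems sub in \<open>auto intro: inj_on_subset\<close>)
  also have "?e {a..<a + 2 ^ Suc K} + real (Suc K) * ?e {a..<a + 2 ^ K} + 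
        real (Suc K) * ?e {a + 2 ^ K..<a + 2 ^ K + 2 ^ K} = real (Suc (Suc K)) * ?e {a..<a + 2 ^ Suc K}"
  proof -
    have "?e {a..<a + 2 ^ Suc K} = ?e {a..<a + 2 ^ K} + ?e {a + 2 ^ K..<a + 2 ^ K + 2 ^ K}"
      by (subst sum.atLeastLessThan_concat) (auto simp: mult_2 add.assoc)
    thus ?thesis by (simp add: algebra_simps)
  qed
  finally show ?case by (simp add: sum.distrib add_divide_distrib)
qed

text \<open>Averaged over the twists, each dyadic interval contributes only its diagonal terms, and each
coefficient lies in \<open>K + 1\<close> dyadic intervals.  So the average dyadic energy tends to \<open>K + 1\<close> times
the sum of the squared coefficients, and some twist stays below twice this value.\<close>

lemma exists_twist_with_small_partial_sums:
  fixes c :: "nat \<Rightarrow> complex"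
  assumes pos: "(\<Sum>N\<in>{1..2 ^ K}. (cmod (c N))\<^sup>2) > 0"
  shows "\<exists>\<tau>::real. \<forall>x\<le>2 ^ K. (cmod (\<Sum>N\<in>{1..x}. c N * of_nat N powr (\<i> * \<tau>)))\<^sup>2
            \<le> 2 * (real (Suc K))\<^sup>2 * (\<Sum>N\<in>{1..2 ^ K}. (cmod (c N))\<^sup>2)"
proof -
  \<comment> \<open>The twists are restricted to multiples of a step \<open>h\<close> so small that the angles \<open>h ln N\<close> stay within
    \<open>[0, \<pi>]\<close>; this makes the numbers \<open>N^(i h)\<close> distinct, and finite averages suffice.\<close>
  define h where "h = 1 / (2 ^ K :: real)"
  define z where "z = (\<lambda>N::nat. cis (h * ln N))"
  have iv: "{1..<1 + x} = {1..x}" for x :: nat by auto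
  have rng: "0 \<le> h * ln N \<and> h * ln N \<le> pi" if "N \<in> {1..2 ^ K}" for N :: nat
  proof -
    have "N \<ge> 1" using that by simp
    hence "ln (real N) < real N" by (intro ln_less_self) simp
    also have "real N \<le> 2 ^ K" using that by (simp flip: of_nat_le_iff)
    finally have "h * ln N < 1" by (simp add: h_def field_simps)
    moreover have "h * ln N \<ge> 0" using \<open>N \<ge> 1\<close> by (simp add: h_def)
    ultimately show ?thesis using pi_gt3 by linarith
  qed
  have "inj_on z {1..2 ^ K}"
  proof (rule inj_onI)
    fix N M assume NM: "N \<in> {1..2 ^ K}" "M \<in> {1..2 ^ K}" "z N = z M"
    have "cos (h * ln N) = cos (h * ln M)"
      using arg_cong[OF NM(3), of Re] by (simp add: z_def)
    hence "h * ln N = h * ln M"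
      using rng[OF NM(1)] rng[OF NM(2)] cos_inj_pi[of "h * ln N" "h * ln M"] by blast
    thus "N = M" using NM by (simp add: h_def)
  qed
  hence lim: "(\<lambda>T. (\<Sum>t<T. dyadic_energy (\<lambda>N. c N * z N ^ t) K 1) / real T)
     \<longlonglongrightarrow> real (Suc K) * (\<Sum>N\<in>{1..2 ^ K}. (cmod (c N))\<^sup>2)"
    by (intro mean_dyadic_energy_tendsto[of 1 K z c, unfolded iv]) (simp_all add: z_def)
  define B where "B = 2 * real (Suc K) * (\<Sum>N\<in>{1..2 ^ K}. (cmod (c N))\<^sup>2)"
  have "real (Suc K) * (\<Sum>N\<in>{1..2 ^ K}. (cmod (c N))\<^sup>2) < B"
    unfolding B_def using pos by simp
  with lim have "\<forall>\<^sub>F T in sequentially. (\<Sum>t<T. dyadic_energy (\<lambda>N. c N * z N ^ t) K 1) / real T < B"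
    by (rule order_tendstoD)
  hence "\<exists>T>0. (\<Sum>t<T. dyadic_energy (\<lambda>N. c N * z N ^ t) K 1) / real T < B"
    by (metis (mono_tags, lifting) eventually_gt_at_top eventually_conj eventually_happens' sequentially_bot)
  then obtain T where T: "T > 0" "(\<Sum>t<T. dyadic_energy (\<lambda>N. c N * z N ^ t) K 1) / real T < B" by blast
  obtain t where t: "dyadic_energy (\<lambda>N. c N * z N ^ t) K 1 \<le> B"
  proof (rule ccontr)
    assume "\<not> thesis"
    hence "B \<le> dyadic_energy (\<lambda>N. c N * z N ^ t) K 1" for t
      using that[of t] by linarith
    hence "(\<Sum>t<T. B) \<le> (\<Sum>t<T. dyadic_energy (\<lambda>N. c N * z N ^ t) K 1)" by (intro sum_mono)
    thus False using T by (simp add: field_simps)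
  qed
  show ?thesis
  proof (intro exI[of _ "h * real t"] allI impI)
    fix x :: nat assume x: "x \<le> 2 ^ K"
    have "(\<Sum>N\<in>{1..x}. c N * of_nat N powr (\<i> * complex_of_real (h * real t))) = (\<Sum>N\<in>{1..<1 + x}. c N * z N ^ t)"
    proof (unfold iv, intro sum.cong refl)
      fix N assume "N \<in> {1..x}"
      hence "of_nat N powr (\<i> * complex_of_real (h * real t)) = exp (\<i> * of_real (h * real t * ln N))"
        by (simp add: powr_def Ln_of_nat mult_ac)
      also have "\<dots> = z N ^ t" unfolding z_def cis_conv_exp exp_of_nat_mult[symmetric] by (simp add: mult_ac)
      finally show "c N * of_nat N powr (\<i> * complex_of_real (h * real t)) = c N * z N ^ t" by simp
    qed
    hence "(cmod (\<Sum>N\<in>{1..x}. c N * of_nat N powr (\<i> * complex_of_real (h * real t))))\<^sup>2 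
        \<le> real (Suc K) * dyadic_energy (\<lambda>N. c N * z N ^ t) K 1"
      using partial_sum_le_dyadic_energy[OF x, of "\<lambda>N. c N * z N ^ t" 1] by simp
    also have "\<dots> \<le> real (Suc K) * B" using t by (intro mult_left_mono) auto
    also have "\<dots> = 2 * (real (Suc K))\<^sup>2 * (\<Sum>N\<in>{1..2 ^ K}. (cmod (c N))\<^sup>2)"
      by (simp only: B_def power2_eq_square mult_ac)
    finally show "(cmod (\<Sum>N\<in>{1..x}. c N * of_nat N powr (\<i> * complex_of_real (h * real t))))\<^sup>2
            \<le> 2 * (real (Suc K))\<^sup>2 * (\<Sum>N\<in>{1..2 ^ K}. (cmod (c N))\<^sup>2)" .
  qed
qed

section \<open>Summation by parts against powers\<close>

lemma norm_exp_minus_1_le: 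
  fixes z :: complex
  shows "cmod (exp z - 1) \<le> exp (cmod z) * cmod z"
proof -
  have "cmod (exp z - exp 0) \<le> exp (cmod z) * cmod (z - 0)"
  proof (rule field_differentiable_bound[of "cball 0 (cmod z)"])
    fix w :: complex assume "w \<in> cball 0 (cmod z)"
    thus "cmod (exp w) \<le> exp (cmod z)"
      using order_trans[OF abs_Re_le_cmod[of w], of "cmod z"] by simp
  qed (auto intro!: derivative_eq_intros)
  thus ?thesis by simp
qed

lemma sum_by_parts_bound:
  fixes b g :: "nat \<Rightarrow> complex"
  assumes "\<And>y. y \<le> x \<Longrightarrow> cmod (\<Sum>N\<in>{1..y}. b N) \<le> M"
  shows "cmod (\<Sum>N\<in>{1..x}. b N * g N)
    \<le> M * (cmod (g x) + (\<Sum>N\<in>{1..<x}. cmod (g N - g (Suc N))))"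
proof -
  define S where "S = (\<lambda>y. \<Sum>N\<in>{1..y}. b N)"
  have "(\<Sum>N\<in>{1..x}. b N * g N) = S x * g x + (\<Sum>N\<in>{1..<x}. S N * (g N - g (Suc N)))"
  proof (induction x)
    case (Suc x)
    show ?case
    proof (cases "x = 0")
      case False
      have "{1..<Suc x} = insert x {1..<x}" using False by auto
      thus ?thesis using Suc by (simp add: S_def algebra_simps)
    qed (simp add: S_def)
  qed (simp add: S_def)
  also have "cmod \<dots> \<le> cmod (S x) * cmod (g x) + (\<Sum>N\<in>{1..<x}. cmod (S N) * cmod (g N - g (Suc N)))"
    by (intro order_trans[OF norm_triangle_ineq] add_mono sum_norm_le) (auto simp: norm_mult)
  also have "\<dots> \<le> M * cmod (g x) + (\<Sum>N\<in>{1..<x}. M * cmod (g N - g (Suc N)))"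
    unfolding S_def by (intro add_mono sum_mono mult_right_mono assms) auto
  finally show ?thesis by (simp add: algebra_simps sum_distrib_left)
qed

text \<open>The quotient \<open>(N+1)^(-s) / N^(-s)\<close> is \<open>exp (-s ln (1 + 1/N))\<close>, whose exponent is at most \<open>R/N\<close>
in modulus.  The dependence on \<open>R\<close> is wasteful but harmless, because \<open>R\<close> will be fixed before the
range of summation.\<close>

lemma powr_variation_bound:
  assumes "N \<ge> 1" "cmod s \<le> R"
  shows "cmod (of_nat N powr (- s) - of_nat (Suc N) powr (- s)) \<le> real N powr (- Re s) * (R * exp R / real N)"
proof -
  define w where "w = - s * of_real (ln (1 + 1 / real N))"
  have l: "0 \<le> ln (1 + 1 / real N)" "ln (1 + 1 / real N) \<le> 1 / real N"
    using assms by (auto intro!: ln_add_one_self_le_self)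
  have "ln (real N * (1 + 1 / real N)) = ln (real N) + ln (1 + 1 / real N)"
    using assms by (intro ln_mult_pos) (auto intro: add_pos_nonneg)
  moreover have "real N * (1 + 1 / real N) = real (Suc N)" using assms by (simp add: field_simps)
  ultimately have ln: "ln (real (Suc N)) = ln (real N) + ln (1 + 1 / real N)" by (simp only:)
  have "of_nat (Suc N) powr (- s) = of_nat N powr (- s) * exp w"
    using assms ln by (simp add: powr_def w_def Ln_of_nat algebra_simps del: of_nat_Suc flip: exp_add)
  hence "cmod (of_nat N powr (- s) - of_nat (Suc N) powr (- s)) = 
     cmod (of_nat N powr (- s) * (exp w - 1))"
    by (simp add: algebra_simps norm_minus_commute)
  also have "\<dots> = real N powr (- Re s) * cmod (exp w - 1)"
    using assms by (simp add: norm_mult norm_powr_real_powr)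
  also have "cmod (exp w - 1) \<le> exp R * (R * (1 / real N))"
  proof -
    have "cmod (exp w - 1) \<le> exp (cmod w) * cmod w" by (rule norm_exp_minus_1_le)
    also have "exp (cmod w) * cmod w \<le> exp R * (R * (1 / real N))"
    proof -
      have "cmod w = cmod s * ln (1 + 1 / real N)" using l(1) by (simp add: w_def norm_mult)
      also have "\<dots> \<le> R * (1 / real N)" using assms l order_trans[OF norm_ge_zero assms(2)] by (intro mult_mono) auto
      finally have 1: "cmod w \<le> R * (1 / real N)" .
      also have "\<dots> \<le> R * 1" using assms order_trans[OF norm_ge_zero assms(2)] by (intro mult_left_mono) auto
      finally have 2: "cmod w \<le> R" by simp
      show ?thesis using 1 2 by (intro mult_mono) auto
    qed
    finally show ?thesis .
  qed
  finally show ?thesis by (simp add: mult_left_mono mult.commute[of R])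
qed

lemma harmonic_sum_le:
  assumes "x \<ge> 1"
  shows "(\<Sum>N\<in>{1..x}. 1 / real N) \<le> 1 + ln (real x)"
  using assms
proof (induction x rule: dec_induct)
  case (step x)
  have "ln (real x) - ln (real (Suc x)) \<le> (real x - real (Suc x)) / real (Suc x)"
    using step by (intro ln_diff_le) auto
  hence "1 / real (Suc x) \<le> ln (real (Suc x)) - ln (real x)" by (simp add: field_simps)
  thus ?case using step by simp
qed simp

text \<open>Small partial sums survive multiplication by \<open>N^(-s)\<close> at the expected cost \<open>U^\<alpha>\<close>, up to a
logarithm and a constant that depends on the bound for \<open>|s|\<close>.\<close>

lemma twisted_sum_bound:
  fixes b :: "nat \<Rightarrow> complex"
  assumes M: "\<And>y. y \<le> x \<Longrightarrow> cmod (\<Sum>N\<in>{1..y}. b N) \<le> M"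
    and x: "real x \<le> U" "U \<ge> 1" and s: "cmod s \<le> R" "Re s \<ge> - \<alpha>" and \<alpha>: "\<alpha> \<ge> 0"
  shows "cmod (\<Sum>N\<in>{1..x}. b N * of_nat N powr (- s)) \<le> M * (U powr \<alpha> * (1 + R * exp R * (1 + ln U)))"
proof -
  have M0: "M \<ge> 0" using M[of 0] by simp
  have R0: "R \<ge> 0" using order_trans[OF norm_ge_zero s(1)] .
  have R1: "R * exp R \<ge> 0" using R0 by simp
  show ?thesis
  proof (cases "x = 0")
    case True
    have "1 + R * exp R * (1 + ln U) \<ge> 0" using R0 x by (intro add_nonneg_nonneg mult_nonneg_nonneg) auto
    thus ?thesis using True M0 by simp
  next
    case False
    have pw: "real N powr (- Re s) \<le> U powr \<alpha>" if "N \<in> {1..x}" for N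
    proof -
      have "real N powr (- Re s) \<le> real N powr \<alpha>" using that s by (intro powr_mono) auto
      also have "\<dots> \<le> U powr \<alpha>" using that x \<alpha> by (intro powr_mono2) auto
      finally show ?thesis .
    qed
    have "cmod (\<Sum>N\<in>{1..x}. b N * of_nat N powr (- s)) \<le> M * (cmod (of_nat x powr (- s)) +
        (\<Sum>N\<in>{1..<x}. cmod (of_nat N powr (- s) - of_nat (Suc N) powr (- s))))"
      by (rule sum_by_parts_bound[OF M])
    also have "\<dots> \<le> M * (U powr \<alpha> + U powr \<alpha> * (R * exp R * (1 + ln U)))"
    proof (intro mult_left_mono add_mono M0)
      show "cmod (of_nat x powr (- s)) \<le> U powr \<alpha>"
        using pw[of x] False by (simp add: norm_powr_real_powr)
      have "(\<Sum>N\<in>{1..<x}. cmod (of_nat N powr (- s) - of_nat (Suc N) powr (- s)))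
         \<le> (\<Sum>N\<in>{1..<x}. U powr \<alpha> * (R * exp R * (1 / real N)))"
      proof (rule sum_mono)
        fix N assume N: "N \<in> {1..<x}"
        have "cmod (of_nat N powr (- s) - of_nat (Suc N) powr (- s)) \<le> real N powr (- Re s) * (R * exp R / real N)"
          using N s by (intro powr_variation_bound) auto
        also have "\<dots> \<le> U powr \<alpha> * (R * exp R / real N)"
          using N R1 by (intro mult_right_mono pw) auto
        finally show "cmod (of_nat N powr (- s) - of_nat (Suc N) powr (- s)) \<le> U powr \<alpha> * (R * exp R * (1 / real N))" by simp
      qed
      also have "\<dots> = U powr \<alpha> * (R * exp R * (\<Sum>N\<in>{1..<x}. 1 / real N))"
        by (simp only: sum_distrib_left)
      also have "(\<Sum>N\<in>{1..<x}. 1 / real N) \<le> (\<Sum>N\<in>{1..x}. 1 / real N)"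
        by (rule sum_mono2) auto
      also have "(\<Sum>N\<in>{1..x}. 1 / real N) \<le> 1 + ln (real x)"
        using False by (intro harmonic_sum_le) auto
      also have "ln (real x) \<le> ln U" using False x by (subst ln_le_cancel_iff) auto
      finally show "(\<Sum>N\<in>{1..<x}. cmod (of_nat N powr (- s) - of_nat (Suc N) powr (- s)))
         \<le> U powr \<alpha> * (R * exp R * (1 + ln U))" using R1 by (simp add: mult_left_mono)
    qed
    finally show ?thesis by (simp add: algebra_simps)
  qed
qed

section \<open>A single block\<close>

text \<open>A finitely supported sequence with the behaviour of one block, for a peak \<open>C\<close>, an error \<open>\<epsilon>\<close> and a
tolerance \<open>\<delta>\<close> around the critical exponents \<open>1/4\<close>, \<open>0\<close> and \<open>-1/4\<close>.  The number \<open>R\<close> is at the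
same time a lower bound for the support and the radius within which partial sums are controlled;
\<open>U\<close> bounds the height \<open>\<tau>\<close> as well as the support, so that a block started at \<open>R = U\<close> is under
control at the peak of the present one.\<close>

definition good_block ::
  "real \<Rightarrow> real \<Rightarrow> real \<Rightarrow> nat \<Rightarrow> (nat \<Rightarrow> complex) \<Rightarrow> real \<Rightarrow> nat \<Rightarrow> bool" where
  "good_block C \<epsilon> \<delta> R b \<tau> U \<longleftrightarrow>
     R < U \<and> \<bar>\<tau>\<bar> \<le> real U \<and>
     (\<forall>N. b N \<noteq> 0 \<longrightarrow> num_prime_factors N = 2 \<and> R < N \<and> N \<le> U) \<and>
     cmod (\<Sum>N\<in>{R<..U}. dterm b (\<i> * \<tau>) N) = C \<and>
     (\<forall>s. 0 \<le> Re s \<longrightarrow> cmod (\<Sum>N\<in>{R<..U}. dterm b s N) \<le> C) \<and>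
     (\<forall>s. \<delta> \<le> Re s \<longrightarrow> cmod (\<Sum>N\<in>{R<..U}. dterm b s N) \<le> \<epsilon>) \<and>
     (\<forall>s. 1/4 + \<delta> \<le> Re s \<longrightarrow> (\<Sum>N\<in>{R<..U}. cmod (dterm b s N)) \<le> \<epsilon>) \<and>
     (\<forall>s. Re s \<le> 1/4 - \<delta> \<longrightarrow> 1 \<le> (\<Sum>N\<in>{R<..U}. cmod (dterm b s N))) \<and>
     (\<forall>s x. - (1/4) + \<delta> \<le> Re s \<and> cmod s \<le> real R \<longrightarrow>
        cmod (\<Sum>N\<in>{R<..x}. dterm b s N) \<le> \<epsilon>)"

text \<open>All requirements on the scale of a block.  In order, after the supply of primes, the inequalities
serve the bound for \<open>Re s \<ge> \<delta>\<close>, the upper and the lower bound for absolute sums, and the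
bound for partial sums.\<close>

lemma exists_block_scale:
  fixes C \<epsilon> \<delta> Q :: real
  assumes "C > 0" "\<epsilon> > 0" "0 < \<delta>" "\<delta> \<le> 1/4" "Q > 0"
  obtains X :: nat where "X > 0" "real X powr (1 - \<delta>) \<ge> Q"
    "8 * real X powr (1 - \<delta>) \<le> card {p. prime p \<and> real X powr (1 - \<delta>) < real p \<and> p \<le> X}"
    "C * real X powr (- (2 * \<delta> * (1 - \<delta>))) \<le> \<epsilon>"
    "C * real X powr (- \<delta>) \<le> \<epsilon>"
    "C * real X powr (3 * \<delta> / 2) \<ge> 1"
    "2 * (2 + 2 * ln (real X) / ln 2) * C * real X powr (- (3 * \<delta> / 2)) * (1 + Q * (1 + 2 * ln (real X))) \<le> \<epsilon>"
proof -
  have "1 - \<delta> > 0" "2 * \<delta> * (1 - \<delta>) > 0" using assms by auto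
  have small: "eventually (\<lambda>j. f j \<le> \<epsilon>) sequentially" if "f \<longlonglongrightarrow> 0" for f :: "nat \<Rightarrow> real"
    using order_tendstoD(2)[OF that assms(2)] by (rule eventually_mono) simp
  define e where "e = 2 * \<delta> * (1 - \<delta>)"
  have e: "e > 0" using \<open>2 * \<delta> * (1 - \<delta>) > 0\<close> by (simp add: e_def)
  have "eventually (\<lambda>j. real (2 * j) powr (1 - \<delta>) \<ge> Q) sequentially" using \<open>1 - \<delta> > 0\<close> by real_asymp
  moreover have "eventually (\<lambda>j. C * real (2 * j) powr (- e) \<le> \<epsilon>) sequentially"
    by (rule small) (use e in real_asymp)
  moreover have "eventually (\<lambda>j. C * real (2 * j) powr (- \<delta>) \<le> \<epsilon>) sequentially"
    by (rule small) (use \<open>\<delta> > 0\<close> in real_asymp)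
  moreover have "eventually (\<lambda>j. C * real (2 * j) powr (3 * \<delta> / 2) \<ge> 1) sequentially"
    using \<open>\<delta> > 0\<close> \<open>C > 0\<close> by real_asymp
  moreover have "eventually (\<lambda>j. 2 * (2 + 2 * ln (real (2 * j)) / ln 2) * C * real (2 * j) powr (- (3 * \<delta> / 2)) * 
      (1 + Q * (1 + 2 * ln (real (2 * j)))) \<le> \<epsilon>) sequentially"
    by (rule small) (use \<open>\<delta> > 0\<close> \<open>C > 0\<close> \<open>Q > 0\<close> in real_asymp)
  moreover note eventually_many_primes[OF assms(3)] eventually_gt_at_top[of "0::nat"]
  ultimately have "eventually (\<lambda>j. real (2 * j) powr (1 - \<delta>) \<ge> Q \<and> C * real (2 * j) powr (- e) \<le> \<epsilon> \<and>
     C * real (2 * j) powr (- \<delta>) \<le> \<epsilon> \<and> C * real (2 * j) powr (3 * \<delta> / 2) \<ge> 1 \<and>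
     2 * (2 + 2 * ln (real (2 * j)) / ln 2) * C * real (2 * j) powr (- (3 * \<delta> / 2)) * 
      (1 + Q * (1 + 2 * ln (real (2 * j)))) \<le> \<epsilon> \<and> 8 * real (2 * j) powr (1 - \<delta>) \<le> 
     card {p. prime p \<and> real (2 * j) powr (1 - \<delta>) < real p \<and> p \<le> 2 * j} \<and> j > 0) sequentially"
    by eventually_elim (intro conjI)
  then obtain j where "real (2 * j) powr (1 - \<delta>) \<ge> Q \<and> C * real (2 * j) powr (- e) \<le> \<epsilon> \<and>
     C * real (2 * j) powr (- \<delta>) \<le> \<epsilon> \<and> C * real (2 * j) powr (3 * \<delta> / 2) \<ge> 1 \<and>
     2 * (2 + 2 * ln (real (2 * j)) / ln 2) * C * real (2 * j) powr (- (3 * \<delta> / 2)) * 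
      (1 + Q * (1 + 2 * ln (real (2 * j)))) \<le> \<epsilon> \<and> 8 * real (2 * j) powr (1 - \<delta>) \<le> 
     card {p. prime p \<and> real (2 * j) powr (1 - \<delta>) < real p \<and> p \<le> 2 * j} \<and> j > 0"
    using eventually_happens[of _ sequentially] by auto
  thus ?thesis unfolding e_def by (elim conjE) (rule that[of "2 * j"]; simp only: mult_pos_pos zero_less_numeral)
qed

text \<open>The exponent is maximal with \<open>2 \<cdot> 4^k \<le> card S\<close>, hence \<open>card S < 8 \<cdot> 4^k\<close>.\<close>

lemma two_disjoint_injections:
  fixes S :: "'a set"
  assumes S: "finite S" "8 * Y \<le> real (card S)" "Y > 1/8"
  obtains k :: nat and p q :: "nat \<Rightarrow> 'a" where "Y \<le> 4 ^ k" "2 * 4 ^ k \<le> card S"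
    "inj_on p {..<4 ^ k}" "inj_on q {..<4 ^ k}" "p ` {..<4 ^ k} \<subseteq> S" "q ` {..<4 ^ k} \<subseteq> S" 
    "p ` {..<4 ^ k} \<inter> q ` {..<4 ^ k} = {}"
proof -
  have "card S > 1" using S by linarith
  hence "card S div 2 \<ge> 1" by linarith
  then obtain k where k: "4 ^ k \<le> card S div 2" "card S div 2 < 4 ^ (k + 1)"
    using ex_power_ivl1[of 4 "card S div 2"] by auto
  have "2 * 4 ^ k \<le> card S" using k by linarith
  then obtain f where f: "inj_on f {..<2 * 4 ^ k :: nat}" "f ` {..<2 * 4 ^ k} \<subseteq> S"
    using card_le_inj[of "{..<2 * 4 ^ k :: nat}" S] S by auto
  have "card S < 8 * 4 ^ k" using k by simp
  hence "real (card S) < real (8 * 4 ^ k)" by linarith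
  hence Y: "Y \<le> 4 ^ k" using S by simp
  show ?thesis
  proof (rule that[of k f "\<lambda>i. f (i + 4 ^ k)"])
    show "inj_on f {..<4 ^ k}" using f(1) by (rule inj_on_subset) auto
    show "inj_on (\<lambda>i. f (i + 4 ^ k)) {..<4 ^ k}"
    proof (rule inj_onI)
      fix i j :: nat assume "i \<in> {..<4 ^ k}" "j \<in> {..<4 ^ k}" "f (i + 4 ^ k) = f (j + 4 ^ k)"
      thus "i = j" using inj_onD[OF f(1), of "i + 4 ^ k" "j + 4 ^ k"] by simp
    qed
    show "f ` {..<4 ^ k} \<inter> (\<lambda>i. f (i + 4 ^ k)) ` {..<4 ^ k} = {}"
    proof (intro equals0I)
      fix y assume "y \<in> f ` {..<4 ^ k} \<inter> (\<lambda>i. f (i + 4 ^ k)) ` {..<4 ^ k}"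
      then obtain i j where "i < 4 ^ k" "j < 4 ^ k" "f i = f (j + 4 ^ k)" by auto
      thus False using f(1) by (auto dest: inj_onD[where x = i and y = "j + 4 ^ k"])
    qed
  qed (use f Y \<open>2 * 4 ^ k \<le> card S\<close> in auto)
qed

lemma prime_product_inj:
  fixes p q :: "nat \<Rightarrow> nat"
  assumes "inj_on p I" "inj_on q I" "p ` I \<inter> q ` I = {}" "\<And>i. i \<in> I \<Longrightarrow> prime (p i)" "\<And>i. i \<in> I \<Longrightarrow> prime (q i)"
  shows "inj_on (\<lambda>(i, j). p i * q j) (I \<times> I)"
proof (rule inj_onI, clarify)
  fix i j i' j' assume I: "i \<in> I" "j \<in> I" "i' \<in> I" "j' \<in> I" and eq: "p i * q j = p i' * q j'"
  have "p i dvd p i' * q j'" using eq by (metis dvd_triv_left)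
  hence "p i dvd p i' \<or> p i dvd q j'" using assms(4)[OF I(1)] by (simp add: prime_dvd_mult_iff)
  hence "p i = p i' \<or> p i = q j'" using assms(4,5) I by (meson primes_dvd_imp_eq)
  moreover have "p i \<noteq> q j'" using assms(3) I by blast
  ultimately have p: "p i = p i'" by simp
  moreover have "p i \<noteq> 0" using assms(4)[OF I(1)] by auto
  ultimately have "q j = q j'" using eq by simp
  thus "i = i' \<and> j = j'" using p assms(1,2) I by (auto dest: inj_onD)
qed

lemma num_prime_factors_prime_mult:
  assumes "prime p" "prime q"
  shows "num_prime_factors (p * q) = 2"
proof -
  have "p \<noteq> 0" "q \<noteq> 0" using assms by auto
  thus ?thesis using assms 
    by (simp add: num_prime_factors_def prime_factorization_mult prime_factorization_prime)
qed

lemma sum_over_image_support: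
  assumes "inj_on \<iota> D" "finite W" "\<iota> ` D \<subseteq> W" "\<And>N. F 0 N = 0"
  shows "(\<Sum>N\<in>W. F (if N \<in> \<iota> ` D then h (inv_into D \<iota> N) else 0) N) = (\<Sum>d\<in>D. F (h d) (\<iota> d))"
proof -
  have "(\<Sum>N\<in>W. F (if N \<in> \<iota> ` D then h (inv_into D \<iota> N) else 0) N) =
        (\<Sum>N\<in>\<iota> ` D. F (if N \<in> \<iota> ` D then h (inv_into D \<iota> N) else 0) N)"
    by (rule sum.mono_neutral_right) (use assms in auto)
  also have "\<dots> = (\<Sum>d\<in>D. F (h d) (\<iota> d))"
    using assms(1) by (subst sum.reindex) (auto simp: o_def intro!: sum.cong)
  finally show ?thesis .
qed

text \<open>The values of the whole block and its absolute sums are governed by the Hadamard matrix and the size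
of the primes alone; the bound for partial sums combines \<open>exists_twist_with_small_partial_sums\<close> with
\<open>twisted_sum_bound\<close>.\<close>

lemma exists_good_block:
  assumes C: "C > 0" and \<epsilon>: "\<epsilon> > 0" and \<delta>: "0 < \<delta>" "\<delta> \<le> 1/4"
  shows "\<exists>b \<tau> U. good_block C \<epsilon> \<delta> R b \<tau> U"
proof -
  define Q where "Q = real R * exp (real R) + real R + 1"
  have "real R * exp (real R) \<ge> 0" by simp
  hence Q: "Q > 0" "Q \<ge> real R * exp (real R)" "Q \<ge> real R + 1" unfolding Q_def by linarith+
  obtain X :: nat where X: "X > 0" "real X powr (1 - \<delta>) \<ge> Q"
    "8 * real X powr (1 - \<delta>) \<le> card {p. prime p \<and> real X powr (1 - \<delta>) < real p \<and> p \<le> X}"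
    "C * real X powr (- (2 * \<delta> * (1 - \<delta>))) \<le> \<epsilon>"
    "C * real X powr (- \<delta>) \<le> \<epsilon>"
    "C * real X powr (3 * \<delta> / 2) \<ge> 1"
    "2 * (2 + 2 * ln (real X) / ln 2) * C * real X powr (- (3 * \<delta> / 2)) * (1 + Q * (1 + 2 * ln (real X))) \<le> \<epsilon>"
    using exists_block_scale[OF C \<epsilon> \<delta> Q(1)] by blast
  define Y where "Y = real X powr (1 - \<delta>)"
  define S where "S = {p. prime p \<and> Y < real p \<and> p \<le> X}"
  have Y: "Y \<ge> real R + 1" "Y \<ge> 1" using X(2) Q(3) by (auto simp: Y_def)
  have X1: "real X \<ge> 1" using X(1) by simp
  have finS: "finite S" unfolding S_def by (rule finite_subset[of _ "{..X}"]) auto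
  obtain k and p q :: "nat \<Rightarrow> nat" where pq: "Y \<le> 4 ^ k" "2 * 4 ^ k \<le> card S"
    "inj_on p {..<4 ^ k}" "inj_on q {..<4 ^ k}" "p ` {..<4 ^ k} \<subseteq> S" "q ` {..<4 ^ k} \<subseteq> S" 
    "p ` {..<4 ^ k} \<inter> q ` {..<4 ^ k} = {}"
    by (rule two_disjoint_injections[of S Y]) (use X(3) Y finS in \<open>auto simp: S_def Y_def\<close>)
  define I where "I = {..<(4::nat) ^ k}"
  define D where "D = I \<times> I"
  define \<iota> where "\<iota> = (\<lambda>(i, j). p i * q j)"
  have pS: "prime (p i)" "Y < real (p i)" "p i \<le> X" and qS: "prime (q i)" "Y < real (q i)" "q i \<le> X"
    if "i \<in> I" for i
    using pq(5,6) that by (auto simp: S_def I_def)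
  have inj: "inj_on \<iota> D" unfolding \<iota>_def D_def
    by (rule prime_product_inj) (use pq(3,4,7) pS qS in \<open>auto simp: I_def\<close>)
  have cardk: "4 ^ k \<le> real X"
  proof -
    have "card S \<le> card {1..X}" by (rule card_mono) (auto simp: S_def prime_ge_Suc_0_nat)
    hence "4 ^ k \<le> X" using pq(2) by simp
    hence "real (4 ^ k) \<le> real X" by linarith
    thus ?thesis by simp
  qed
  have range: "R < \<iota> d" "\<iota> d \<le> X\<^sup>2" "num_prime_factors (\<iota> d) = 2" if dD: "d \<in> D" for d
  proof -
    obtain i j where d: "d = (i, j)" "i \<in> I" "j \<in> I" using dD by (auto simp: D_def)
    have "real R < real (p i)" using pS(2)[OF d(2)] Y by linarith
    hence "R < p i * 1" by simp
    also have "p i * 1 \<le> p i * q j" using qS(1)[OF d(3)] by (intro mult_left_mono) (auto dest: prime_ge_1_nat)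
    finally show "R < \<iota> d" by (simp add: \<iota>_def d)
    show "\<iota> d \<le> X\<^sup>2" unfolding \<iota>_def d power2_eq_square prod.case by (intro mult_mono pS qS d) auto
    show "num_prime_factors (\<iota> d) = 2" using d pS(1) qS(1) by (simp add: \<iota>_def num_prime_factors_prime_mult)
  qed
  define \<beta> where "\<beta> = (\<lambda>N. if N \<in> \<iota> ` D then (case inv_into D \<iota> N of (i, j) \<Rightarrow> hadamard k i j) else 0)"
  have \<beta>_sum: "(\<Sum>N\<in>W. F (\<beta> N) N) = (\<Sum>i<4 ^ k. \<Sum>j<4 ^ k. F (hadamard k i j) (p i * q j))"
    if "finite W" "\<iota> ` D \<subseteq> W" "\<And>N. F 0 N = 0" for F :: "real \<Rightarrow> nat \<Rightarrow> complex" and W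
    unfolding \<beta>_def
    by (subst sum_over_image_support[where F = F, OF inj that(1,2)]) (use that(3) in simp, simp add: D_def I_def \<iota>_def sum.cartesian_product case_prod_unfold)
  have \<beta>_sum_real: "(\<Sum>N\<in>W. F (\<beta> N) N) = (\<Sum>i<4 ^ k. \<Sum>j<4 ^ k. F (hadamard k i j) (p i * q j))"
    if "finite W" "\<iota> ` D \<subseteq> W" "\<And>N. F 0 N = 0" for F :: "real \<Rightarrow> nat \<Rightarrow> real" and W
    unfolding \<beta>_def
    by (subst sum_over_image_support[where F = F, OF inj that(1,2)]) (use that(3) in simp, simp add: D_def I_def \<iota>_def sum.cartesian_product case_prod_unfold)
  have \<beta>0: "\<beta> N = 0" if "N \<notin> \<iota> ` D" for N using that by (simp add: \<beta>_def)
  define A where "A = C / 8 ^ k"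
  have A: "A > 0" using C by (simp add: A_def)
  define K where "K = nat \<lceil>2 * log 2 (real X)\<rceil>"
  have log0: "log 2 (real X) \<ge> 0" using X1 by simp
  have K: "real X ^ 2 \<le> 2 ^ K" "real (Suc K) \<le> 2 + 2 * ln (real X) / ln 2"
  proof -
    have "real K \<ge> 2 * log 2 (real X)" unfolding K_def by linarith
    hence "2 powr (2 * log 2 (real X)) \<le> 2 powr real K" by (intro powr_mono) auto
    also have "2 powr (2 * log 2 (real X)) = (2 powr log 2 (real X)) powr 2" by (simp add: powr_powr mult.commute)
    also have "2 powr log 2 (real X) = real X" using X1 by simp
    finally show "real X ^ 2 \<le> 2 ^ K" using X1 by (simp add: powr_realpow)
    have "real K \<le> 2 * log 2 (real X) + 1" unfolding K_def using log0 by linarith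
    thus "real (Suc K) \<le> 2 + 2 * ln (real X) / ln 2" by (simp add: log_def)
  qed
  have XK: "X\<^sup>2 \<le> 2 ^ K" using K(1) of_nat_le_iff[of "X\<^sup>2" "2 ^ K", where ?'a = real] by simp
  define c where "c = (\<lambda>N. complex_of_real (A * \<beta> N))"
  have im: "\<iota> ` D \<subseteq> {1..2 ^ K}"
  proof (rule image_subsetI)
    fix d assume "d \<in> D"
    thus "\<iota> d \<in> {1..2 ^ K}" using range(1,2)[of d] XK by simp
  qed
  have energy: "(\<Sum>N\<in>{1..2 ^ K}. (cmod (c N))\<^sup>2) = C\<^sup>2 / 4 ^ k"
  proof -
    have "(\<Sum>N\<in>{1..2 ^ K}. (cmod (c N))\<^sup>2) = (\<Sum>N\<in>{1..2 ^ K}. (A * \<beta> N)\<^sup>2)"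
      by (simp only: c_def norm_of_real power2_abs)
    also have "\<dots> = (\<Sum>i<4 ^ k. \<Sum>j<4 ^ k. (A * hadamard k i j)\<^sup>2)"
      by (rule \<beta>_sum_real[where F = "\<lambda>v N. (A * v)\<^sup>2"]) (use im in auto)
    also have "\<dots> = (4 ^ k * 4 ^ k) * A\<^sup>2"
    proof -
      have "(hadamard k i j)\<^sup>2 = 1" for i j using power2_abs[of "hadamard k i j"] by simp
      thus ?thesis by (simp add: power_mult_distrib)
    qed
    also have "(4 ^ k * 4 ^ k) * A\<^sup>2 = C\<^sup>2 * ((4 ^ k * 4 ^ k) / (8 ^ k * 8 ^ k))"
      by (simp add: A_def power2_eq_square)
    also have "(8 ^ k * 8 ^ k :: real) = (4 ^ k * 4 ^ k) * 4 ^ k" by (simp flip: power_mult_distrib)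
    finally show ?thesis by simp
  qed
  obtain \<tau> :: real where \<tau>: "\<And>x. x \<le> 2 ^ K \<Longrightarrow> (cmod (\<Sum>N\<in>{1..x}. c N * of_nat N powr (\<i> * \<tau>)))\<^sup>2
            \<le> 2 * (real (Suc K))\<^sup>2 * (C\<^sup>2 / 4 ^ k)"
    using exists_twist_with_small_partial_sums[where K = K and c = c] C unfolding energy by auto
  define b where "b = (\<lambda>N. c N * of_nat N powr (\<i> * \<tau>))"
  define U where "U = X\<^sup>2 + nat \<lceil>\<bar>\<tau>\<bar>\<rceil> + R + 1"
  have supp: "N \<in> \<iota> ` D" if "b N \<noteq> 0" for N using that \<beta>0[of N] by (auto simp: b_def c_def)
  have sub: "\<iota> ` D \<subseteq> {R<..U}" using range by (force simp: U_def)

  have norm_pow: "cmod (of_nat N powr (\<i> * \<tau>)) = 1" if "N > 0" for N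
    using that by (simp add: norm_powr_real_powr)
  have dsum: "(\<Sum>N\<in>{R<..U}. dterm b s N) = of_real A * (\<Sum>i<4 ^ k. \<Sum>j<4 ^ k. of_real (hadamard k i j) * 
       (of_nat (p i) powr (\<i> * \<tau> - s) * of_nat (q j) powr (\<i> * \<tau> - s)))" for s
  proof -
    have "(\<Sum>N\<in>{R<..U}. dterm b s N) = (\<Sum>i<4 ^ k. \<Sum>j<4 ^ k. of_real (A * hadamard k i j) * 
         of_nat (p i * q j) powr (\<i> * \<tau>) * of_nat (p i * q j) powr (- s))"
      unfolding dterm_def b_def c_def
      by (rule \<beta>_sum[where F = "\<lambda>v N. of_real (A * v) * of_nat N powr (\<i> * \<tau>) * of_nat N powr (- s)"])
         (use sub in auto)
    also have "\<dots> = (\<Sum>i<4 ^ k. \<Sum>j<4 ^ k. of_real A * (of_real (hadamard k i j) * 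
       (of_nat (p i) powr (\<i> * \<tau> - s) * of_nat (q j) powr (\<i> * \<tau> - s))))"
    proof (intro sum.cong refl)
      fix i j :: nat assume "i \<in> {..<4 ^ k}" "j \<in> {..<4 ^ k}"
      hence "p i > 0" "q j > 0" using pS(1) qS(1) by (auto simp: I_def prime_gt_0_nat)
      hence "of_nat (p i * q j) powr (\<i> * \<tau>) * of_nat (p i * q j) powr (- s) = 
          of_nat (p i * q j) powr (\<i> * \<tau> - s)"
        by (simp add: powr_def flip: exp_add) (simp add: algebra_simps)
      also have "\<dots> = of_nat (p i) powr (\<i> * \<tau> - s) * of_nat (q j) powr (\<i> * \<tau> - s)"
        by (simp add: powr_times_real)
      finally show "of_real (A * hadamard k i j) * of_nat (p i * q j) powr (\<i> * \<tau>) * of_nat (p i * q j) powr (- s)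
        = of_real A * (of_real (hadamard k i j) * 
       (of_nat (p i) powr (\<i> * \<tau> - s) * of_nat (q j) powr (\<i> * \<tau> - s)))"
        by (simp only: of_real_mult mult.assoc)
    qed
    finally show ?thesis by (simp only: sum_distrib_left)
  qed
  \<comment> \<open>At \<open>s = i \<tau>\<close> the twist cancels and the form is evaluated at the all-ones vectors.\<close>
  have peak: "cmod (\<Sum>N\<in>{R<..U}. dterm b (\<i> * \<tau>) N) = C"
  proof -
    have "(\<Sum>i<4 ^ k. \<Sum>j<4 ^ k. of_real (hadamard k i j) * 
       (of_nat (p i) powr (\<i> * \<tau> - \<i> * \<tau>) * of_nat (q j) powr (\<i> * \<tau> - \<i> * \<tau>)))
       = (\<Sum>i<4 ^ k. complex_of_real (\<Sum>j<4 ^ k. hadamard k i j))"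
      unfolding of_real_sum
    proof (intro sum.cong refl)
      fix i j :: nat assume "i \<in> {..<4 ^ k}" "j \<in> {..<4 ^ k}"
      hence "p i \<noteq> 0" "q j \<noteq> 0" using pS(1)[of i] qS(1)[of j] by (auto simp: I_def)
      thus "of_real (hadamard k i j) * (of_nat (p i) powr (\<i> * \<tau> - \<i> * \<tau>) * 
         of_nat (q j) powr (\<i> * \<tau> - \<i> * \<tau>)) = complex_of_real (hadamard k i j)" by simp
    qed
    also have "\<dots> = 4 ^ k * 2 ^ k" by (simp add: hadamard_row_sum)
    also have "\<dots> = 8 ^ k" by (simp flip: power_mult_distrib)
    finally show ?thesis unfolding dsum using C by (simp add: A_def norm_mult norm_divide norm_power)
  qed
  have bilinear: "cmod (\<Sum>N\<in>{R<..U}. dterm b s N) \<le> C * Y powr (- (2 * Re s))" if s: "Re s \<ge> 0" for s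
  proof -
    have pw: "cmod (of_nat N powr (\<i> * \<tau> - s)) \<le> Y powr (- Re s)" if "Y < real N" for N
    proof -
      have "cmod (of_nat N powr (\<i> * \<tau> - s)) = real N powr (- Re s)"
        using that Y by (simp add: norm_powr_real_powr)
      also have "\<dots> \<le> Y powr (- Re s)" using that Y s by (intro powr_mono2') auto
      finally show ?thesis .
    qed
    have "cmod (\<Sum>N\<in>{R<..U}. dterm b s N) \<le> A * (8 ^ k * (Y powr (- Re s))\<^sup>2)"
      unfolding dsum norm_mult using A
      by (intro mult_mono hadamard_bilinear_bound pw pS qS) (auto simp: I_def)
    also have "\<dots> = C * (Y powr (- Re s) * Y powr (- Re s))" by (simp add: A_def power2_eq_square)
    also have "Y powr (- Re s) * Y powr (- Re s) = Y powr (- (2 * Re s))" by (simp flip: powr_add)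
    finally show ?thesis .
  qed
  have bound0: "cmod (\<Sum>N\<in>{R<..U}. dterm b s N) \<le> C" if "0 \<le> Re s" for s
  proof -
    have "Y powr (- (2 * Re s)) \<le> Y powr 0" using Y that by (intro powr_mono) auto
    hence "C * Y powr (- (2 * Re s)) \<le> C * 1" using C Y by (intro mult_left_mono) auto
    thus ?thesis using bilinear[OF that] by simp
  qed
  have bound1: "cmod (\<Sum>N\<in>{R<..U}. dterm b s N) \<le> \<epsilon>" if "\<delta> \<le> Re s" for s
  proof -
    have "Y powr (- (2 * Re s)) \<le> Y powr (- (2 * \<delta>))" using Y that by (intro powr_mono) auto
    also have "\<dots> = real X powr (- (2 * \<delta> * (1 - \<delta>)))" by (simp add: Y_def powr_powr mult_ac)
    finally have "C * Y powr (- (2 * Re s)) \<le> C * real X powr (- (2 * \<delta> * (1 - \<delta>)))"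
      using C by (intro mult_left_mono) auto
    thus ?thesis using bilinear[of s] that \<delta> X(4) by linarith
  qed
  have absum: "(\<Sum>N\<in>{R<..U}. cmod (dterm b s N)) = A * (\<Sum>i<4 ^ k. \<Sum>j<4 ^ k. real (p i * q j) powr (- Re s))" for s
  proof -
    have "(\<Sum>N\<in>{R<..U}. cmod (dterm b s N)) = (\<Sum>N\<in>{R<..U}. A * \<bar>\<beta> N\<bar> * real N powr (- Re s))"
      using A norm_pow by (intro sum.cong refl) 
        (auto simp: dterm_def b_def c_def norm_mult norm_powr_real_powr)
    also have "\<dots> = (\<Sum>i<4 ^ k. \<Sum>j<4 ^ k. A * \<bar>hadamard k i j\<bar> * real (p i * q j) powr (- Re s))"
      by (rule \<beta>_sum_real[where F = "\<lambda>v N. A * \<bar>v\<bar> * real N powr (- Re s)"]) (use sub in auto)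
    finally show ?thesis by (simp add: sum_distrib_left)
  qed
  have A_card: "A * (4 ^ k * 4 ^ k) = C * 2 ^ k"
  proof -
    have "(4 ^ k * 4 ^ k :: real) = 8 ^ k * 2 ^ k" by (simp flip: power_mult_distrib)
    thus ?thesis by (simp add: A_def)
  qed
  have two_k: "(2 :: real) ^ k = sqrt (4 ^ k)" 
    using real_sqrt_abs[of "2 ^ k"] by (simp add: power2_eq_square flip: power_mult_distrib)
  have two_k_le: "2 ^ k \<le> real X powr (1/2)" 
    using cardk X1 by (simp add: two_k powr_half_sqrt)
  have two_k_ge: "Y powr (1/2) \<le> 2 ^ k" using pq(1) Y by (simp add: two_k powr_half_sqrt)
  have bound2: "(\<Sum>N\<in>{R<..U}. cmod (dterm b s N)) \<le> \<epsilon>" if s: "1/4 + \<delta> \<le> Re s" for s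
  proof -
    have "real (p i * q j) powr (- Re s) \<le> Y powr (- (1/2 + 2 * \<delta>))" if "i < 4 ^ k" "j < 4 ^ k" for i j
    proof -
      have "Y * Y \<le> real (p i) * real (q j)" using pS(2)[of i] qS(2)[of j] that Y by (intro mult_mono) (auto simp: I_def)
      moreover have "Y * Y \<ge> 1" using Y mult_mono[of 1 Y 1 Y] by simp
      ultimately have "real (p i * q j) powr (- Re s) \<le> (Y * Y) powr (- Re s)"
        using s \<delta> by (intro powr_mono2') auto
      also have "\<dots> \<le> (Y * Y) powr (- (1/4 + \<delta>))" using s \<open>Y * Y \<ge> 1\<close> by (intro powr_mono) auto
      also have "\<dots> = Y powr (- (1/2 + 2 * \<delta>))" using Y by (simp add: powr_mult flip: powr_add)
      finally show ?thesis .
    qed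
    hence "(\<Sum>N\<in>{R<..U}. cmod (dterm b s N)) \<le> A * (\<Sum>i<(4::nat) ^ k. \<Sum>j<(4::nat) ^ k. Y powr (- (1/2 + 2 * \<delta>)))"
      unfolding absum using A by (intro mult_left_mono sum_mono) auto
    also have "\<dots> = C * 2 ^ k * Y powr (- (1/2 + 2 * \<delta>))" by (simp flip: A_card)
    also have "\<dots> \<le> C * real X powr (1/2) * Y powr (- (1/2 + 2 * \<delta>))"
      using C two_k_le by (intro mult_right_mono mult_left_mono) auto
    also have "\<dots> = C * real X powr (1/2 + (1 - \<delta>) * (- (1/2 + 2 * \<delta>)))"
      by (simp only: Y_def powr_powr powr_add mult.assoc)
    also have "\<dots> \<le> C * real X powr (- \<delta>)"
    proof (intro mult_left_mono powr_mono)
      have "\<delta> * \<delta> \<le> \<delta> * (1/4)" using \<delta> by (intro mult_left_mono) auto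
      moreover have "1/2 + (1 - \<delta>) * (- (1/2 + 2 * \<delta>)) = 2 * (\<delta> * \<delta>) - 3/2 * \<delta>"
        by (simp add: field_simps)
      ultimately show "1/2 + (1 - \<delta>) * (- (1/2 + 2 * \<delta>)) \<le> - \<delta>" by linarith
    qed (use C X1 in auto)
    finally show ?thesis using X(5) by linarith
  qed
  have bound3: "1 \<le> (\<Sum>N\<in>{R<..U}. cmod (dterm b s N))" if s: "Re s \<le> 1/4 - \<delta>" for s
  proof -
    have pw: "real X powr (- (1/2 - 2 * \<delta>)) \<le> real (p i * q j) powr (- Re s)" if "i < 4 ^ k" "j < 4 ^ k" for i j
    proof -
      have "p i > 0" "q j > 0" using pS(1)[of i] qS(1)[of j] that by (auto simp: I_def prime_gt_0_nat)
      hence ge: "p i * q j \<ge> 1" by simp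
      have le: "real (p i * q j) \<le> real (X * X)" using pS(3)[of i] qS(3)[of j] that
        by (intro of_nat_mono mult_mono) (auto simp: I_def)
      have "real X powr (- (1/2 - 2 * \<delta>)) = real (X * X) powr (- (1/4 - \<delta>))"
        using X1 by (simp add: powr_mult flip: powr_add)
      also have "\<dots> \<le> real (p i * q j) powr (- (1/4 - \<delta>))"
        using ge le \<delta> by (intro powr_mono2') (auto simp del: of_nat_mult)
      also have "\<dots> \<le> real (p i * q j) powr (- Re s)"
        using ge s by (intro powr_mono) (auto simp del: of_nat_mult)
      finally show ?thesis .
    qed
    have "1 \<le> C * real X powr (3 * \<delta> / 2)" by (rule X(6))
    also have "3 * \<delta> / 2 = (1 - \<delta>) * (1/2) + (- (1/2 - 2 * \<delta>))" by (simp add: field_simps)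
    also have "real X powr \<dots> = Y powr (1/2) * real X powr (- (1/2 - 2 * \<delta>))"
      by (simp only: powr_add Y_def powr_powr)
    also have "C * \<dots> \<le> C * (2 ^ k * real X powr (- (1/2 - 2 * \<delta>)))"
      using C two_k_ge by (intro mult_left_mono mult_right_mono) auto
    also have "\<dots> = A * (\<Sum>i<(4::nat) ^ k. \<Sum>j<(4::nat) ^ k. real X powr (- (1/2 - 2 * \<delta>)))"
      using A_card by simp
    also have "\<dots> \<le> (\<Sum>N\<in>{R<..U}. cmod (dterm b s N))"
      unfolding absum using A by (intro mult_left_mono sum_mono pw) auto
    finally show ?thesis .
  qed
  have bound4: "cmod (\<Sum>N\<in>{R<..x}. dterm b s N) \<le> \<epsilon>" if s: "- (1/4) + \<delta> \<le> Re s" "cmod s \<le> real R" for s x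
  proof -
    \<comment> \<open>Beyond \<open>X\<^sup>2\<close> the coefficients vanish, so the partial sums may be stopped there.\<close>
    define y where "y = min x (X\<^sup>2)"
    define M where "M = 2 * real (Suc K) * C / 2 ^ k"
    have y: "y \<le> X\<^sup>2" by (simp add: y_def)
    have "(\<Sum>N\<in>{R<..x}. dterm b s N) = (\<Sum>N\<in>{1..y}. dterm b s N)"
    proof (rule sum.mono_neutral_cong)
      fix N assume N: "N \<in> {1..y} - {R<..x}"
      hence "N \<notin> \<iota> ` D" using range by (auto simp: y_def)
      thus "dterm b s N = 0" using supp[of N] by (auto simp: dterm_def)
    next
      fix N assume N: "N \<in> {R<..x} - {1..y}"
      hence "N \<notin> \<iota> ` D" using range by (force simp: y_def)
      thus "dterm b s N = 0" using supp[of N] by (auto simp: dterm_def)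
    qed auto
    also have "\<dots> = (\<Sum>N\<in>{1..y}. b N * of_nat N powr (- s))" by (simp add: dterm_def)
    also have "cmod \<dots> \<le> M * (((real X)\<^sup>2) powr (1/4 - \<delta>) * (1 + real R * exp (real R) * (1 + ln ((real X)\<^sup>2))))"
    proof (rule twisted_sum_bound)
      fix z assume "z \<le> y"
      hence "z \<le> 2 ^ K" using y XK by linarith
      hence "(cmod (\<Sum>N\<in>{1..z}. b N))\<^sup>2 \<le> 2 * (real (Suc K))\<^sup>2 * (C\<^sup>2 / 4 ^ k)" unfolding b_def by (rule \<tau>)
      also have "\<dots> \<le> 4 * (real (Suc K))\<^sup>2 * (C\<^sup>2 / 4 ^ k)" by (intro mult_right_mono) auto
      also have "\<dots> = M\<^sup>2"
      proof -
        have "(4 :: real) ^ k = (2 ^ k)\<^sup>2" by (simp add: power2_eq_square flip: power_mult_distrib)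
        thus ?thesis by (simp add: M_def power_mult_distrib power_divide del: of_nat_Suc)
      qed
      finally show "cmod (\<Sum>N\<in>{1..z}. b N) \<le> M"
        by (rule power2_le_imp_le) (use C in \<open>simp add: M_def\<close>)
    next
      have "real y \<le> real (X\<^sup>2)" using y by linarith
      thus "real y \<le> (real X)\<^sup>2" by simp
    qed (use s \<delta> X1 in auto)
    also have "\<dots> \<le> M * (((real X)\<^sup>2) powr (1/4 - \<delta>) * (1 + Q * (1 + 2 * ln (real X))))"
    proof -
      have ln: "ln ((real X)\<^sup>2) = 2 * ln (real X)" using X1 by (simp add: ln_realpow)
      have "real R * exp (real R) * (1 + 2 * ln (real X)) \<le> Q * (1 + 2 * ln (real X))"
        using Q(2) X1 by (intro mult_right_mono) auto
      moreover have "M \<ge> 0" using C by (simp add: M_def)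
      ultimately show ?thesis unfolding ln by (intro mult_left_mono) auto
    qed
    also have "\<dots> \<le> (2 * (2 + 2 * ln (real X) / ln 2) * C * Y powr (- (1/2))) *
         (((real X)\<^sup>2) powr (1/4 - \<delta>) * (1 + Q * (1 + 2 * ln (real X))))"
    proof (intro mult_right_mono)
      have "M = 2 * real (Suc K) * C * inverse (2 ^ k)" by (simp add: M_def field_simps)
      also have "inverse (2 ^ k) \<le> Y powr (- (1/2))"
        unfolding powr_minus using two_k_ge Y by (intro le_imp_inverse_le) auto
      also have "2 * real (Suc K) * C * Y powr (- (1/2)) \<le> 2 * (2 + 2 * ln (real X) / ln 2) * C * Y powr (- (1/2))"
        using K(2) C by (intro mult_right_mono mult_left_mono) auto
      finally show "M \<le> 2 * (2 + 2 * ln (real X) / ln 2) * C * Y powr (- (1/2))"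
        using C by simp
    qed (use Q X1 in \<open>auto intro!: mult_nonneg_nonneg add_nonneg_nonneg\<close>)
    also have "\<dots> = 2 * (2 + 2 * ln (real X) / ln 2) * C * (Y powr (- (1/2)) * ((real X)\<^sup>2) powr (1/4 - \<delta>)) *
         (1 + Q * (1 + 2 * ln (real X)))" by (simp only: mult.assoc)
    also have "Y powr (- (1/2)) * ((real X)\<^sup>2) powr (1/4 - \<delta>) = real X powr ((1 - \<delta>) * (- (1/2)) + 2 * (1/4 - \<delta>))"
      using X1 by (simp only: Y_def powr_powr powr_add powr_power) (simp flip: powr_numeral add: powr_powr)
    also have "(1 - \<delta>) * (- (1/2)) + 2 * (1/4 - \<delta>) = - (3 * \<delta> / 2)" by (simp add: field_simps)
    finally show ?thesis using X(7) by linarith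
  qed
  have "good_block C \<epsilon> \<delta> R b \<tau> U"
    unfolding good_block_def
  proof (intro conjI)
    show "R < U" by (simp add: U_def)
    show "\<bar>\<tau>\<bar> \<le> real U" unfolding U_def by linarith
    show "\<forall>N. b N \<noteq> 0 \<longrightarrow> num_prime_factors N = 2 \<and> R < N \<and> N \<le> U"
      using supp sub range by (fastforce simp: image_iff)
  qed (use peak bound0 bound1 bound2 bound3 bound4 in blast)+
  thus ?thesis by blast
qed

section \<open>Series assembled from blocks\<close>

text \<open>Summing from the beginning of block \<open>M\<close>, one collects complete blocks and one incomplete block, and
the total is dominated by a geometric series.\<close>

lemma blockwise_small:
  fixes f :: "nat \<Rightarrow> 'a :: real_normed_vector" and L :: "nat \<Rightarrow> nat"
  assumes L: "strict_mono L"
    and f: "\<And>k x. M \<le> k \<Longrightarrow> x \<le> L (Suc k) \<Longrightarrow> norm (\<Sum>N\<in>{L k<..x}. f N) \<le> (1/2) ^ k"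
    and x: "L M \<le> x"
  shows "norm (\<Sum>N\<in>{L M<..x}. f N) \<le> 2 * (1/2) ^ M"
proof -
  have split: "(\<Sum>N\<in>{a<..c}. f N) = (\<Sum>N\<in>{a<..b}. f N) + (\<Sum>N\<in>{b<..c}. f N)" 
    if "a \<le> b" "b \<le> c" for a b c
  proof -
    have "{a<..c} = {a<..b} \<union> {b<..c}" using that by auto
    thus ?thesis by (simp add: sum.union_disjoint Int_def)
  qed
  have "norm (\<Sum>N\<in>{L M<..x}. f N) \<le> 2 * (1/2) ^ M - 2 * (1/2) ^ (M + j)"
    if "L M \<le> x" "x \<le> L (M + j)" for j x
    using that
  proof (induction j arbitrary: x)
    case (Suc j)
    show ?case
    proof (cases "x \<le> L (M + j)")
      case True
      have "norm (\<Sum>N\<in>{L M<..x}. f N) \<le> 2 * (1/2) ^ M - 2 * (1/2) ^ (M + j)"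
        by (rule Suc.IH) (use Suc.prems True in auto)
      also have "\<dots> \<le> 2 * (1/2) ^ M - 2 * (1/2) ^ (M + Suc j)" by simp
      finally show ?thesis .
    next
      case False
      have mono: "L M \<le> L (M + j)" using L by (simp add: strict_mono_less_eq)
      have "norm (\<Sum>N\<in>{L M<..x}. f N) \<le> 
          norm (\<Sum>N\<in>{L M<..L (M + j)}. f N) + norm (\<Sum>N\<in>{L (M + j)<..x}. f N)"
        using split[of "L M" "L (M + j)" x] mono False by (simp add: norm_triangle_ineq)
      also have "\<dots> \<le> (2 * (1/2) ^ M - 2 * (1/2) ^ (M + j)) + (1/2) ^ (M + j)"
        using Suc.prems mono by (intro add_mono Suc.IH f) auto
      also have "\<dots> = 2 * (1/2) ^ M - 2 * (1/2) ^ (M + Suc j)" by simp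
      finally show ?thesis .
    qed
  qed auto
  from this[OF x, of x] have "norm (\<Sum>N\<in>{L M<..x}. f N) \<le> 2 * (1/2) ^ M - 2 * (1/2) ^ (M + x)"
    using strict_mono_imp_increasing[OF L, of "M + x"] by simp
  also have "\<dots> \<le> 2 * (1/2) ^ M" by simp
  finally show ?thesis .
qed

lemma blockwise_summable:
  fixes f :: "nat \<Rightarrow> 'a :: banach" and L :: "nat \<Rightarrow> nat"
  assumes L: "strict_mono L"
    and f: "\<And>k x. M \<le> k \<Longrightarrow> x \<le> L (Suc k) \<Longrightarrow> norm (\<Sum>N\<in>{L k<..x}. f N) \<le> (1/2) ^ k"
  shows "summable (\<lambda>n. f (Suc n))"
    and "norm ((\<Sum>n. f (Suc n)) - (\<Sum>N\<in>{0<..L M}. f N)) \<le> 2 * (1/2) ^ M"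
proof -
  define P where "P = (\<lambda>x. \<Sum>n<x. f (Suc n))"
  have P: "P x = (\<Sum>N\<in>{0<..x}. f N)" for x
  proof (induction x)
    case (Suc x)
    have "{0<..Suc x} = insert (Suc x) {0<..x}" by auto
    thus ?case using Suc by (simp add: P_def add.commute)
  qed (simp add: P_def)
  have diff: "P x - P (L k) = (\<Sum>N\<in>{L k<..x}. f N)" if "L k \<le> x" for x k
  proof -
    have "{0<..x} = {0<..L k} \<union> {L k<..x}" using that by auto
    thus ?thesis by (simp add: P sum.union_disjoint Int_def)
  qed
  have close: "norm (P x - P (L k)) \<le> 2 * (1/2) ^ k" if "M \<le> k" "L k \<le> x" for k x
    using blockwise_small[OF L, of k f x] f that by (simp add: diff)
  have "Cauchy P"
  proof (rule metric_CauchyI)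
    fix e :: real assume "e > 0"
    have "(\<lambda>k. 4 * (1/2 :: real) ^ k) \<longlonglongrightarrow> 0" by real_asymp
    hence "\<forall>\<^sub>F k in sequentially. 4 * (1/2) ^ k < e" using \<open>e > 0\<close> by (rule order_tendstoD)
    hence "\<forall>\<^sub>F k in sequentially. 4 * (1/2) ^ k < e \<and> k \<ge> M"
      using eventually_ge_at_top[of M] by (rule eventually_conj)
    then obtain k where k: "4 * (1/2) ^ k < e" "k \<ge> M"
      using eventually_happens[of _ sequentially] by auto
    have "dist (P x) (P y) < e" if "x \<ge> L k" "y \<ge> L k" for x y
    proof -
      have "dist (P x) (P y) \<le> norm (P x - P (L k)) + norm (P y - P (L k))"
        by (metis dist_norm dist_triangle2)
      also have "\<dots> \<le> 2 * (1/2) ^ k + 2 * (1/2) ^ k" using that k by (intro add_mono close) auto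
      also have "\<dots> < e" using k by simp
      finally show ?thesis .
    qed
    thus "\<exists>M. \<forall>m\<ge>M. \<forall>n\<ge>M. dist (P m) (P n) < e" by blast
  qed
  hence conv: "convergent P" by (simp add: Cauchy_convergent_iff)
  thus sm: "summable (\<lambda>n. f (Suc n))" by (simp add: summable_iff_convergent P_def)
  hence "P \<longlonglongrightarrow> (\<Sum>n. f (Suc n))" unfolding P_def by (rule summable_LIMSEQ)
  hence "(\<lambda>x. norm (P x - P (L M))) \<longlonglongrightarrow> norm ((\<Sum>n. f (Suc n)) - P (L M))"
    by (intro tendsto_intros)
  hence "norm ((\<Sum>n. f (Suc n)) - P (L M)) \<le> 2 * (1/2) ^ M"
    by (rule tendsto_upperbound) (use close in \<open>auto intro!: eventually_sequentiallyI[of "L M"]\<close>)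
  thus "norm ((\<Sum>n. f (Suc n)) - (\<Sum>N\<in>{0<..L M}. f N)) \<le> 2 * (1/2) ^ M" by (simp add: P)
qed

lemma sum_blocks:
  fixes f :: "nat \<Rightarrow> 'a :: comm_monoid_add" and L :: "nat \<Rightarrow> nat"
  assumes L: "strict_mono L" "L 0 = 0"
  shows "(\<Sum>N\<in>{0<..L m}. f N) = (\<Sum>k<m. \<Sum>N\<in>{L k<..L (Suc k)}. f N)"
proof (induction m)
  case (Suc m)
  have "L m \<le> L (Suc m)" using L by (simp add: strict_mono_less_eq)
  hence "{0<..L (Suc m)} = {0<..L m} \<union> {L m<..L (Suc m)}" by auto
  thus ?case using Suc by (simp add: sum.union_disjoint Int_def)
qed (simp add: L)

text \<open>Only the behaviour strictly to one side of \<open>x\<close> matters, so the abscissae can be computed without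
deciding what happens on the critical line.\<close>

lemma Inf_ereal_image_le:
  assumes "\<And>\<sigma>::real. x < \<sigma> \<Longrightarrow> \<sigma> \<in> A"
  shows "Inf (ereal ` A) \<le> ereal x"
proof (rule dense_ge)
  fix y assume "ereal x < y"
  then obtain r where r: "ereal x < ereal r" "ereal r < y" using ereal_dense2 by blast
  hence "Inf (ereal ` A) \<le> ereal r" using assms by (intro Inf_lower) auto
  thus "Inf (ereal ` A) \<le> y" using r by simp
qed

lemma Inf_ereal_image_eq:
  assumes "\<And>\<sigma>::real. x < \<sigma> \<Longrightarrow> \<sigma> \<in> A" "\<And>\<sigma>. \<sigma> < x \<Longrightarrow> \<sigma> \<notin> A"
  shows "Inf (ereal ` A) = ereal x"
proof (rule antisym)
  show "ereal x \<le> Inf (ereal ` A)" using assms(2) by (intro Inf_greatest) (auto simp: not_less[symmetric])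
qed (rule Inf_ereal_image_le[OF assms(1)])

lemma eventually_delta: 
  assumes "0 < (e :: real)"
  shows "eventually (\<lambda>k. 1 / (real k + 4) \<le> e) sequentially"
  using assms by real_asymp

(* The first equation already forces the abscissae of absolute and of bounded convergence to be
   finite, since a difference of extended reals with an infinite argument is infinite.  The
   abscissa of convergence is then finite as well, being at least the abscissa of absolute
   convergence minus 1. *)
theorem mainTheorem1:
  shows "\<exists>a :: nat \<Rightarrow> complex. homogeneous 2 a \<and>
    abscissa_abs a - abscissa_bdd a = ereal (1 / 4) \<and>
    abscissa_bdd a - abscissa_conv a \<ge> ereal (1 / 4)"
proof -
  define \<delta> where "\<delta> = (\<lambda>k::nat. 1 / (real k + 4))"
  have ev: "eventually (\<lambda>k. \<delta> k \<le> e) sequentially" if "e > 0" for e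
    unfolding \<delta>_def by (rule eventually_delta[OF that])
  have "\<forall>m R. \<exists>b \<tau> U. good_block (4 ^ m) ((1/2) ^ m) (\<delta> m) R b \<tau> U"
    by (intro allI exists_good_block) (auto simp: \<delta>_def field_simps)
  then obtain bb \<tau>\<tau> UU where 
    blocks: "good_block (4 ^ m) ((1/2) ^ m) (\<delta> m) R (bb m R) (\<tau>\<tau> m R) (UU m R)" for m R
    by metis
  \<comment> \<open>Each block starts where the preceding one ends, in particular above the height of its peak.\<close>
  define L where "L = rec_nat 0 UU"
  have L0: "L 0 = 0" and LS: "L (Suc m) = UU m (L m)" for m by (simp_all add: L_def)
  define b where "b = (\<lambda>m. bb m (L m))"
  define \<tau> where "\<tau> = (\<lambda>m. \<tau>\<tau> m (L m))"
  define B where "B = (\<lambda>k s. \<Sum>N\<in>{L k<..L (Suc k)}. dterm (b k) s N)"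
  define A where "A = (\<lambda>k s. \<Sum>N\<in>{L k<..L (Suc k)}. cmod (dterm (b k) s N))"
  have gb: "good_block (4 ^ k) ((1/2) ^ k) (\<delta> k) (L k) (b k) (\<tau> k) (L (Suc k))" for k
    unfolding LS b_def \<tau>_def by (rule blocks)
  note gb' = gb[unfolded good_block_def]
  have mono: "strict_mono L" using gb' by (intro strict_monoI_Suc) blast
  have L_ge: "k \<le> L k" for k using strict_mono_imp_increasing[OF mono] .
  have tau: "\<bar>\<tau> k\<bar> \<le> L (Suc k)" for k using gb' by blast
  have supp: "b k N \<noteq> 0 \<Longrightarrow> num_prime_factors N = 2 \<and> L k < N \<and> N \<le> L (Suc k)" for k N
    using gb' by blast
  have peak: "cmod (B k (\<i> * \<tau> k)) = 4 ^ k" for k unfolding B_def using gb' by blast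
  have B4: "0 \<le> Re s \<Longrightarrow> cmod (B k s) \<le> 4 ^ k" for k s unfolding B_def using gb' by blast
  have B2: "\<delta> k \<le> Re s \<Longrightarrow> cmod (B k s) \<le> (1/2) ^ k" for k s unfolding B_def using gb' by blast
  have A_le: "1/4 + \<delta> k \<le> Re s \<Longrightarrow> A k s \<le> (1/2) ^ k" for k s unfolding A_def using gb' by blast
  have A_ge: "Re s \<le> 1/4 - \<delta> k \<Longrightarrow> 1 \<le> A k s" for k s unfolding A_def using gb' by blast
  have part: "- (1/4) + \<delta> k \<le> Re s \<Longrightarrow> cmod s \<le> L k \<Longrightarrow> 
      cmod (\<Sum>N\<in>{L k<..x}. dterm (b k) s N) \<le> (1/2) ^ k" for k s x using gb' by blast
  define a where "a = (\<lambda>N. \<Sum>m<N. b m N)"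
  have a_eq: "a N = b k N" if "L k < N" "N \<le> L (Suc k)" for k N
  proof -
    have z: "b m N = 0" if "m \<noteq> k" for m
    proof (rule ccontr)
      assume "b m N \<noteq> 0"
      hence "L m < N" "N \<le> L (Suc m)" using supp by auto
      hence "L m < L (Suc k)" "L k < L (Suc m)" using \<open>L k < N\<close> \<open>N \<le> L (Suc k)\<close> by auto
      thus False using that mono by (simp add: strict_mono_less)
    qed
    have "k < N" using L_ge[of k] that by linarith
    have "a N = (\<Sum>m\<in>{k}. b m N)" unfolding a_def
      by (rule sum.mono_neutral_right) (use z \<open>k < N\<close> in auto)
    thus ?thesis by simp
  qed
  have d_eq: "dterm a s N = dterm (b k) s N" if "N \<in> {L k<..L (Suc k)}" for k N s
    using a_eq[of k N] that by (simp add: dterm_def)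
  have partial_blocks: "(\<Sum>N\<in>{0<..L m}. dterm a s N) = (\<Sum>k<m. B k s)" for m s
    unfolding sum_blocks[OF mono L0] B_def by (intro sum.cong refl d_eq)

  have conv_and_close: "dirichlet_converges a s \<and> cmod (dirichlet_sum a s - (\<Sum>k<M. B k s)) \<le> 2 * (1/2) ^ M"
    if M: "\<And>k. M \<le> k \<Longrightarrow> - (1/4) + \<delta> k \<le> Re s \<and> cmod s \<le> L k" for M s
  proof -
    have *: "cmod (\<Sum>N\<in>{L k<..x}. dterm a s N) \<le> (1/2) ^ k" if "M \<le> k" "x \<le> L (Suc k)" for k x
    proof -
      have "(\<Sum>N\<in>{L k<..x}. dterm a s N) = (\<Sum>N\<in>{L k<..x}. dterm (b k) s N)"
        using that by (intro sum.cong refl d_eq) auto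
      thus ?thesis using part[of k s x] M[OF that(1)] by simp
    qed
    show ?thesis unfolding dirichlet_converges_def dirichlet_sum_def
      using blockwise_summable[OF mono, of M "dterm a s"] * by (simp add: partial_blocks)
  qed
  have ev_close: "\<forall>\<^sub>F M in sequentially. dirichlet_converges a s \<and> 
      cmod (dirichlet_sum a s - (\<Sum>k<M. B k s)) \<le> 2 * (1/2) ^ M" if "Re s > - (1/4)" for s
  proof -
    have "\<forall>\<^sub>F k in sequentially. \<delta> k \<le> Re s + 1/4" by (rule ev) (use that in simp)
    moreover have "\<forall>\<^sub>F k in sequentially. cmod s \<le> real k" by real_asymp
    ultimately have "\<forall>\<^sub>F k in sequentially. - (1/4) + \<delta> k \<le> Re s \<and> cmod s \<le> L k"
    proof eventually_elim
      case (elim k)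
      have "real k \<le> real (L k)" using L_ge[of k] by simp
      thus ?case using elim by linarith
    qed
    then obtain M0 where "\<forall>k\<ge>M0. - (1/4) + \<delta> k \<le> Re s \<and> cmod s \<le> L k"
      by (auto simp: eventually_sequentially)
    thus ?thesis by (intro eventually_sequentiallyI[of M0] conv_and_close) auto
  qed
  have conv: "dirichlet_converges a s" if "Re s > - (1/4)" for s
    using ev_close[OF that] eventually_happens[of _ sequentially] by auto

  have abs: "abscissa_abs a = ereal (1/4)"
    unfolding abscissa_abs_def
  proof (rule Inf_ereal_image_eq)
    fix \<sigma> :: real assume \<sigma>: "1/4 < \<sigma>"
    have "dirichlet_abs_converges a s" if s: "Re s > \<sigma>" for s
    proof -
      have "\<forall>\<^sub>F k in sequentially. \<delta> k \<le> Re s - 1/4" by (rule ev) (use s \<sigma> in simp)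
      then obtain M where M: "\<And>k. k \<ge> M \<Longrightarrow> \<delta> k \<le> Re s - 1/4" by (auto simp: eventually_sequentially)
      have "norm (\<Sum>N\<in>{L k<..x}. cmod (dterm a s N)) \<le> (1/2) ^ k" if "M \<le> k" "x \<le> L (Suc k)" for k x
      proof -
        have "norm (\<Sum>N\<in>{L k<..x}. cmod (dterm a s N)) = (\<Sum>N\<in>{L k<..x}. cmod (dterm a s N))"
          by (simp add: sum_nonneg)
        also have "\<dots> \<le> (\<Sum>N\<in>{L k<..L (Suc k)}. cmod (dterm a s N))"
          using that by (intro sum_mono2) auto
        also have "\<dots> = A k s" unfolding A_def by (intro sum.cong refl arg_cong[of _ _ cmod] d_eq)
        also have "\<dots> \<le> (1/2) ^ k" using M[OF that(1)] by (intro A_le) simp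
        finally show ?thesis .
      qed
      thus ?thesis unfolding dirichlet_abs_converges_def
        by (rule blockwise_summable(1)[OF mono, of M])
    qed
    thus "\<sigma> \<in> {\<sigma>. \<forall>s\<in>right_half_plane \<sigma>. dirichlet_abs_converges a s}"
      by (simp add: right_half_plane_def)
  next
    fix \<sigma> :: real assume \<sigma>: "\<sigma> < 1/4"
    define \<sigma>' where "\<sigma>' = (\<sigma> + 1/4) / 2"
    have \<sigma>': "\<sigma> < \<sigma>'" "\<sigma>' < 1/4" using \<sigma> by (auto simp: \<sigma>'_def)
    have "\<not> dirichlet_abs_converges a (of_real \<sigma>')"
    proof
      assume "dirichlet_abs_converges a (of_real \<sigma>')"
      hence "\<exists>K. \<forall>m\<ge>K. \<forall>n. norm (\<Sum>N\<in>{m..<n}. cmod (dterm a (of_real \<sigma>') (Suc N))) < 1"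
        unfolding dirichlet_abs_converges_def summable_Cauchy by (rule allE[of _ 1]) simp
      then obtain K where K: "\<And>m n. m \<ge> K \<Longrightarrow> norm (\<Sum>N\<in>{m..<n}. cmod (dterm a (of_real \<sigma>') (Suc N))) < 1"
        by blast
      have "\<forall>\<^sub>F k in sequentially. \<delta> k \<le> 1/4 - \<sigma>'" by (rule ev) (use \<sigma>' in simp)
      hence "\<forall>\<^sub>F k in sequentially. \<delta> k \<le> 1/4 - \<sigma>' \<and> k \<ge> K"
        using eventually_ge_at_top[of K] by (rule eventually_conj)
      then obtain k where k: "\<delta> k \<le> 1/4 - \<sigma>'" "k \<ge> K"
        using eventually_happens[of _ sequentially] by auto
      have "1 \<le> A k (of_real \<sigma>')" using k by (intro A_ge) simp
      also have "A k (of_real \<sigma>') = (\<Sum>N\<in>{L k<..L (Suc k)}. cmod (dterm a (of_real \<sigma>') N))"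
        unfolding A_def by (intro sum.cong refl arg_cong[of _ _ cmod] d_eq[symmetric])
      also have "{L k<..L (Suc k)} = {Suc (L k)..<Suc (L (Suc k))}" by auto
      also have "(\<Sum>N\<in>\<dots>. cmod (dterm a (of_real \<sigma>') N)) = 
          (\<Sum>N\<in>{L k..<L (Suc k)}. cmod (dterm a (of_real \<sigma>') (Suc N)))"
        by (rule sum.shift_bounds_Suc_ivl)
      also have "\<dots> \<le> norm \<dots>" by simp
      also have "\<dots> < 1" using K[of "L k"] L_ge[of k] k by simp
      finally show False by simp
    qed
    thus "\<sigma> \<notin> {\<sigma>. \<forall>s\<in>right_half_plane \<sigma>. dirichlet_abs_converges a s}"
      using \<sigma>' by (auto simp: right_half_plane_def intro!: exI[of _ "complex_of_real \<sigma>'"])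
  qed

  have bdd: "abscissa_bdd a = ereal 0"
    unfolding abscissa_bdd_def
  proof (rule Inf_ereal_image_eq)
    fix \<sigma> :: real assume \<sigma>: "0 < \<sigma>"
    obtain k0 where k0: "\<And>k. k \<ge> k0 \<Longrightarrow> \<delta> k \<le> \<sigma>" using ev[OF \<sigma>] by (auto simp: eventually_sequentially)
    have "cmod (dirichlet_sum a s) \<le> (\<Sum>k<k0. 4 ^ k) + 4" if s: "Re s > \<sigma>" for s
    proof -
      have "Re s > - (1/4)" using s \<sigma> by simp
      then obtain M where M: "cmod (dirichlet_sum a s - (\<Sum>k<M. B k s)) \<le> 2 * (1/2) ^ M"
        using ev_close eventually_happens[of _ sequentially] by auto
      have "cmod (\<Sum>k<M. B k s) \<le> (\<Sum>k<M. (if k < k0 then 4 ^ k else 0) + (1/2) ^ k)"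
      proof (rule sum_norm_le)
        fix k
        show "cmod (B k s) \<le> (if k < k0 then 4 ^ k else 0) + (1/2) ^ k"
        proof (cases "k < k0")
          case True
          have "cmod (B k s) \<le> 4 ^ k" using s \<sigma> by (intro B4) simp
          thus ?thesis using True by (simp add: add_increasing2)
        next
          case False
          thus ?thesis using B2[of k s] k0[of k] s by simp
        qed
      qed
      also have "\<dots> = (\<Sum>k<M. (if k < k0 then 4 ^ k else 0)) + (\<Sum>k<M. (1/2) ^ k)"
        by (rule sum.distrib)
      also have "(\<Sum>k<M. (if k < k0 then 4 ^ k else 0)) \<le> (\<Sum>k<k0. 4 ^ k :: real)"
        by (subst sum.inter_filter[symmetric]) (auto intro!: sum_mono2)
      also have "(\<Sum>k<M. (1/2 :: real) ^ k) \<le> 2" by (simp add: sum_gp_strict)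
      finally have "cmod (\<Sum>k<M. B k s) \<le> (\<Sum>k<k0. 4 ^ k) + 2" by simp
      moreover have "(1/2 :: real) ^ M \<le> 1" by (rule power_le_one) auto
      ultimately show ?thesis using M norm_triangle_ineq2[of "dirichlet_sum a s" "\<Sum>k<M. B k s"] by linarith
    qed
    hence "bounded (dirichlet_sum a ` right_half_plane \<sigma>)"
      by (auto simp: bounded_iff right_half_plane_def)
    thus "\<sigma> \<in> {\<sigma>. (\<forall>s\<in>right_half_plane \<sigma>. dirichlet_converges a s) \<and>
                      bounded (dirichlet_sum a ` right_half_plane \<sigma>)}"
      using \<sigma> conv by (auto simp: right_half_plane_def)
  next
    fix \<sigma> :: real assume \<sigma>: "\<sigma> < 0"
    \<comment> \<open>At the peak of block \<open>m\<close> the earlier blocks add up to less than \<open>4^m / 3\<close> and the later ones to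
      at most 1.\<close>
    have "\<not> bounded (dirichlet_sum a ` right_half_plane \<sigma>)"
    proof
      assume "bounded (dirichlet_sum a ` right_half_plane \<sigma>)"
      then obtain D where D: "\<And>s. \<sigma> < Re s \<Longrightarrow> cmod (dirichlet_sum a s) \<le> D"
        by (auto simp: bounded_iff right_half_plane_def)
      have "4 ^ m \<le> 3/2 * (D + 1)" for m :: nat
      proof -
        define s where "s = \<i> * complex_of_real (\<tau> m)"
        have s: "Re s = 0" "cmod s = \<bar>\<tau> m\<bar>" by (simp_all add: s_def norm_mult)
        have "cmod (dirichlet_sum a s - (\<Sum>k<Suc m. B k s)) \<le> 2 * (1/2) ^ Suc m"
        proof (rule conv_and_close[THEN conjunct2])
          fix k assume k: "Suc m \<le> k"
          have "real (L (Suc m)) \<le> real (L k)" using k mono by (simp add: strict_mono_less_eq)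
          moreover have "\<delta> k \<le> 1/4" by (simp add: \<delta>_def field_simps)
          ultimately show "- (1/4) + \<delta> k \<le> Re s \<and> cmod s \<le> L k" using tau[of m] s by simp
        qed
        also have "\<dots> \<le> 1" by (simp add: power_le_one)
        finally have 1: "cmod (dirichlet_sum a s - (\<Sum>k<Suc m. B k s)) \<le> 1" .
        have 2: "cmod (\<Sum>k<m. B k s) \<le> (\<Sum>k<m. 4 ^ k)"
          using s by (intro sum_norm_le B4) simp
        have 3: "(\<Sum>k<m. 4 ^ k :: real) = (4 ^ m - 1) / 3"
          by (simp add: sum_gp_strict field_simps)
        have "B m s = dirichlet_sum a s - (dirichlet_sum a s - (\<Sum>k<Suc m. B k s)) - (\<Sum>k<m. B k s)"
          by simp
        hence "cmod (B m s) \<le> cmod (dirichlet_sum a s) + cmod (dirichlet_sum a s - (\<Sum>k<Suc m. B k s)) + cmod (\<Sum>k<m. B k s)"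
          by (metis norm_triangle_ineq4 order_trans add_right_mono)
        moreover have "cmod (B m s) = 4 ^ m" unfolding s_def by (rule peak)
        moreover have "cmod (dirichlet_sum a s) \<le> D" by (rule D) (use \<sigma> s in simp)
        ultimately have "4 ^ m \<le> D + 1 + (4 ^ m - 1) / 3" using 1 2 unfolding 3 by linarith
        thus ?thesis by (simp add: field_simps)
      qed
      moreover obtain m where "3/2 * (D + 1) < 4 ^ m" using real_arch_pow[of 4 "3/2 * (D + 1)"] by auto
      ultimately show False by (meson not_less)
    qed
    thus "\<sigma> \<notin> {\<sigma>. (\<forall>s\<in>right_half_plane \<sigma>. dirichlet_converges a s) \<and>
                      bounded (dirichlet_sum a ` right_half_plane \<sigma>)}" by simp
  qed

  have cv: "abscissa_conv a \<le> ereal (- (1/4))"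
    unfolding abscissa_conv_def
    by (rule Inf_ereal_image_le) (auto simp: right_half_plane_def intro!: conv)
  have "homogeneous 2 a"
    unfolding homogeneous_def
  proof (intro allI impI)
    fix N assume "a N \<noteq> 0"
    then obtain m where "b m N \<noteq> 0" unfolding a_def by (meson sum.not_neutral_contains_not_neutral)
    thus "num_prime_factors N = 2" using supp by blast
  qed
  moreover have "abscissa_abs a - abscissa_bdd a = ereal (1 / 4)" by (simp add: abs bdd)
  moreover have "abscissa_bdd a - abscissa_conv a \<ge> ereal (1 / 4)"
    using cv unfolding bdd by (cases "abscissa_conv a") auto
  ultimately show ?thesis by blast
qed

end
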